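(* Let $G$ be any finitely generated group, and suppose $H_1(G)$ is finite. Let $S$ be a finite symmetric generating set. Suppose $Q(G)$ is finite dimensional but nonzero. Let $g_n$ be obtained by random walk of length $n$ with respect to the uniform measure on $S$. Then for any $\epsilon>0$ there are positive constants $a,b$ depending on $\epsilon$ such that $$\mathbf{P}\left(a<\frac{\mathrm{scl}(g_n)}{\sqrt n}<b\right)\ge1-\epsilon$$ for all sufficiently large $n$.
   Context: $Q(G)$ is the real vector space of homogeneous quasimorphisms on $G$: functions $\phi:G\to\mathbb{R}$ with $\sup_{g,h}|\phi(gh)-\phi(g)-\phi(h)|<\infty$ and $\phi(g^m)=m\phi(g)$ for all $g\in G$, $m\in\mathbb{Z}$. The random walk is $g_n=s_1\cdots s_n$ with the $s_i$ independent and uniform on $S$. For $g\in[G,G]$, $\mathrm{cl}(g)$ is the least number of commutators with product $g$, and $\mathrm{scl}(g)=\lim_{m\to\infty}\mathrm{cl}(g^m)/m$; since $H_1(G)$ is finite, every $g\in G$ has a positive power in $[G,G]$, and one sets $\mathrm{scl}(g)=\mathrm{scl}(g^m)/m$ for any $m>0$ with $g^m\in[G,G]$. *)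

theory Defs
  imports
    "HOL-Probability.Probability"
    "HOL-Algebra.Algebra"
    "HOL-Library.Function_Algebras"
begin

section \<open>Homogeneous quasimorphisms\<close>

global_interpretation real_fun: vector_space "\<lambda>(c::real) (\<phi>::'a \<Rightarrow> real) x. c * \<phi> x"
  by unfold_locales (auto simp: fun_eq_iff algebra_simps)

definition quasimorphism :: "('a, 'b) monoid_scheme \<Rightarrow> ('a \<Rightarrow> real) \<Rightarrow> bool" where
  "quasimorphism G \<phi> \<longleftrightarrow>
     bdd_above {\<bar>\<phi> (g \<otimes>\<^bsub>G\<^esub> h) - \<phi> g - \<phi> h\<bar> | g h. g \<in> carrier G \<and> h \<in> carrier G}"

text \<open>
  A function on the group is represented by its extension by zero to the whole type,
  so that equality of representatives is equality on the carrier and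
  the homogeneous quasimorphisms form a linear subspace of the functions on the type.
\<close>

definition homogeneous_quasimorphisms :: "('a, 'b) monoid_scheme \<Rightarrow> ('a \<Rightarrow> real) set" where
  "homogeneous_quasimorphisms G =
     {\<phi>. quasimorphism G \<phi> \<and>
          (\<forall>g\<in>carrier G. \<forall>m::int. \<phi> (g [^]\<^bsub>G\<^esub> m) = of_int m * \<phi> g) \<and>
          (\<forall>g. g \<notin> carrier G \<longrightarrow> \<phi> g = 0)}"

lemma quasimorphism_iff:
  "quasimorphism G \<phi> \<longleftrightarrow>
     (\<exists>D. \<forall>g\<in>carrier G. \<forall>h\<in>carrier G. \<bar>\<phi> (g \<otimes>\<^bsub>G\<^esub> h) - \<phi> g - \<phi> h\<bar> \<le> D)"
  unfolding quasimorphism_def bdd_above_def by blast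

lemma subspace_homogeneous_quasimorphisms:
  "real_fun.subspace (homogeneous_quasimorphisms G)"
proof (rule real_fun.subspaceI)
  show "0 \<in> homogeneous_quasimorphisms G"
    by (auto simp: homogeneous_quasimorphisms_def quasimorphism_iff)
next
  fix \<phi> \<psi> assume *: "\<phi> \<in> homogeneous_quasimorphisms G" "\<psi> \<in> homogeneous_quasimorphisms G"
  then obtain D E where
    D: "\<forall>g\<in>carrier G. \<forall>h\<in>carrier G. \<bar>\<phi> (g \<otimes>\<^bsub>G\<^esub> h) - \<phi> g - \<phi> h\<bar> \<le> D" and
    E: "\<forall>g\<in>carrier G. \<forall>h\<in>carrier G. \<bar>\<psi> (g \<otimes>\<^bsub>G\<^esub> h) - \<psi> g - \<psi> h\<bar> \<le> E"
    by (auto simp: homogeneous_quasimorphisms_def quasimorphism_iff)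
  have "\<bar>(\<phi> + \<psi>) (g \<otimes>\<^bsub>G\<^esub> h) - (\<phi> + \<psi>) g - (\<phi> + \<psi>) h\<bar> \<le> D + E"
    if "g \<in> carrier G" "h \<in> carrier G" for g h
    using D[rule_format, OF that] E[rule_format, OF that] by simp
  then have "quasimorphism G (\<phi> + \<psi>)"
    unfolding quasimorphism_iff by blast
  then show "\<phi> + \<psi> \<in> homogeneous_quasimorphisms G"
    using * by (auto simp: homogeneous_quasimorphisms_def algebra_simps)
next
  fix c :: real and \<phi> assume *: "\<phi> \<in> homogeneous_quasimorphisms G"
  then obtain D where
    D: "\<forall>g\<in>carrier G. \<forall>h\<in>carrier G. \<bar>\<phi> (g \<otimes>\<^bsub>G\<^esub> h) - \<phi> g - \<phi> h\<bar> \<le> D"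
    by (auto simp: homogeneous_quasimorphisms_def quasimorphism_iff)
  have "\<bar>c * \<phi> (g \<otimes>\<^bsub>G\<^esub> h) - c * \<phi> g - c * \<phi> h\<bar> \<le> \<bar>c\<bar> * D"
    if "g \<in> carrier G" "h \<in> carrier G" for g h
  proof -
    have "c * \<phi> (g \<otimes>\<^bsub>G\<^esub> h) - c * \<phi> g - c * \<phi> h = c * (\<phi> (g \<otimes>\<^bsub>G\<^esub> h) - \<phi> g - \<phi> h)"
      by (simp add: algebra_simps)
    then show ?thesis
      using D that by (simp add: abs_mult mult_left_mono)
  qed
  then have "quasimorphism G (\<lambda>x. c * \<phi> x)"
    unfolding quasimorphism_iff by blast
  then show "(\<lambda>x. c * \<phi> x) \<in> homogeneous_quasimorphisms G"
    using * by (auto simp: homogeneous_quasimorphisms_def)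
qed

definition finite_dimensional :: "('a \<Rightarrow> real) set \<Rightarrow> bool" where
  "finite_dimensional V \<longleftrightarrow> (\<exists>B. finite B \<and> B \<subseteq> V \<and> real_fun.span B = V)"


section \<open>Stable commutator length\<close>

abbreviation commutator_subgroup :: "('a, 'b) monoid_scheme \<Rightarrow> 'a set" where
  "commutator_subgroup G \<equiv> derived G (carrier G)"

definition comm_length :: "('a, 'b) monoid_scheme \<Rightarrow> 'a \<Rightarrow> nat" where
  "comm_length G g =
     (LEAST n. \<exists>cs. length cs = n \<and> set cs \<subseteq> derived_set G (carrier G) \<and>
                    g = foldr (mult G) cs \<one>\<^bsub>G\<^esub>)"

definition scl_derived :: "('a, 'b) monoid_scheme \<Rightarrow> 'a \<Rightarrow> real" where
  "scl_derived G g = lim (\<lambda>m. real (comm_length G (g [^]\<^bsub>G\<^esub> m)) / real m)"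

text \<open>
  The value does not depend on the positive power that is used (lemma \<open>scl_eq\<close> below); the
  definition takes the least one.
\<close>

definition scl :: "('a, 'b) monoid_scheme \<Rightarrow> 'a \<Rightarrow> real" where
  "scl G g =
     (let m = (LEAST m::nat. 0 < m \<and> g [^]\<^bsub>G\<^esub> m \<in> commutator_subgroup G)
      in scl_derived G (g [^]\<^bsub>G\<^esub> m) / real m)"

lemma subadditive_convergent:
  fixes f :: "nat \<Rightarrow> real"
  assumes nonneg: "\<And>n. 0 \<le> f n" and sub: "\<And>m n. f (m + n) \<le> f m + f n"
  shows "convergent (\<lambda>n. f n / real n)"
proof -
  define L where "L = (INF n\<in>{1..}. f n / real n)"
  have bdd: "bdd_below ((\<lambda>n. f n / real n) ` {1..})"
    by (rule bdd_belowI[of _ 0]) (auto simp: nonneg)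
  have "(\<lambda>n. f n / real n) \<longlonglongrightarrow> L"
  proof (rule LIMSEQ_I)
    fix e :: real assume e: "0 < e"
    have "\<exists>m\<in>{1..}. f m / real m < L + e / 2"
      using cINF_less_iff[OF _ bdd, of "L + e / 2"] e by (auto simp: L_def)
    then obtain m where m: "m \<ge> 1" "f m / real m < L + e / 2"
      by auto
    define C where "C = (\<Sum>r<m. f r)"
    have C: "f r \<le> C" if "r < m" for r
      unfolding C_def using that by (intro member_le_sum) (auto simp: nonneg)
    have C0: "0 \<le> C"
      unfolding C_def by (intro sum_nonneg) (auto simp: nonneg)
    have mult: "f (q * m + r) \<le> real q * f m + f r" for q r
    proof (induction q)
      case (Suc q)
      have "f (Suc q * m + r) \<le> f m + f (q * m + r)"
        using sub[of m "q * m + r"] by (simp add: add.assoc)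
      with Suc show ?case by (simp add: algebra_simps)
    qed simp
    obtain N where N: "real N > 2 * C / e"
      using reals_Archimedean2 by blast
    show "\<exists>N. \<forall>n\<ge>N. norm (f n / real n - L) < e"
    proof (intro exI[of _ "max N 1"] allI impI)
      fix n assume n: "n \<ge> max N 1"
      have lower: "L \<le> f n / real n"
        unfolding L_def using n by (intro cINF_lower[OF bdd]) auto
      have "f n \<le> real (n div m) * f m + f (n mod m)"
        using mult[of "n div m" "n mod m"] by simp
      also have "\<dots> \<le> (real n / real m) * f m + C"
        using m C[of "n mod m"] nonneg[of m] of_nat_div_le_of_nat[of n m, where ?'a = real]
        by (intro add_mono mult_right_mono) auto
      finally have "f n / real n \<le> ((real n / real m) * f m + C) / real n"
        by (rule divide_right_mono) simp
      also have "\<dots> = f m / real m + C / real n"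
        using n by (simp add: field_simps)
      also have "C / real n < e / 2"
      proof -
        have "2 * C / e < real n"
          using N n by linarith
        then show ?thesis
          using e n by (simp add: field_simps)
      qed
      finally show "norm (f n / real n - L) < e"
        using m lower by simp
    qed
  qed
  then show ?thesis
    by (rule convergentI)
qed

context group
begin

lemma foldr_mult_append:
  assumes "set cs \<subseteq> carrier G" "set ds \<subseteq> carrier G"
  shows "foldr (mult G) (cs @ ds) \<one> = foldr (mult G) cs \<one> \<otimes> foldr (mult G) ds \<one>
         \<and> foldr (mult G) ds \<one> \<in> carrier G"
proof -
  have closed: "foldr (mult G) xs \<one> \<in> carrier G" if "set xs \<subseteq> carrier G" for xs
    using that by (induction xs) auto
  show ?thesis
    using assms by (induction cs) (auto simp: closed m_assoc)
qed

lemma ex_commutator_product: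
  assumes "g \<in> commutator_subgroup G"
  shows "\<exists>cs. set cs \<subseteq> derived_set G (carrier G) \<and> g = foldr (mult G) cs \<one>"
  using assms unfolding derived_def
proof (induction rule: generate.induct)
  case one
  show ?case by (rule exI[of _ "[]"]) simp
next
  case (incl h)
  moreover have "h \<in> carrier G"
    using incl derived_set_in_carrier by blast
  ultimately show ?case by (intro exI[of _ "[h]"]) simp
next
  case (inv h)
  then obtain x y where xy: "x \<in> carrier G" "y \<in> carrier G" "h = x \<otimes> y \<otimes> inv x \<otimes> inv y"
    by blast
  then have "inv h = y \<otimes> x \<otimes> inv y \<otimes> inv x"
    by (simp add: inv_mult_group m_assoc)
  with xy show ?case by (intro exI[of _ "[inv h]"]) auto
next
  case (eng g h)
  then obtain cs ds where "set cs \<subseteq> derived_set G (carrier G)" "g = foldr (mult G) cs \<one>"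
    "set ds \<subseteq> derived_set G (carrier G)" "h = foldr (mult G) ds \<one>"
    by blast
  then show ?case
    using foldr_mult_append[of cs ds] derived_set_in_carrier[of "carrier G"]
    by (intro exI[of _ "cs @ ds"]) auto
qed

lemma comm_length_witness:
  assumes "g \<in> commutator_subgroup G"
  obtains cs where "length cs = comm_length G g" "set cs \<subseteq> derived_set G (carrier G)"
    "g = foldr (mult G) cs \<one>"
proof -
  have "\<exists>n cs. length cs = n \<and> set cs \<subseteq> derived_set G (carrier G) \<and> g = foldr (mult G) cs \<one>"
    using ex_commutator_product[OF assms] by blast
  from LeastI_ex[OF this] that show ?thesis
    unfolding comm_length_def by blast
qed

lemma comm_length_mult_le:
  assumes "g \<in> commutator_subgroup G" "h \<in> commutator_subgroup G"
  shows "comm_length G (g \<otimes> h) \<le> comm_length G g + comm_length G h"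
proof -
  obtain cs where cs: "length cs = comm_length G g" "set cs \<subseteq> derived_set G (carrier G)"
    "g = foldr (mult G) cs \<one>"
    using comm_length_witness[OF assms(1)] .
  obtain ds where ds: "length ds = comm_length G h" "set ds \<subseteq> derived_set G (carrier G)"
    "h = foldr (mult G) ds \<one>"
    using comm_length_witness[OF assms(2)] .
  have "g \<otimes> h = foldr (mult G) (cs @ ds) \<one>"
    using foldr_mult_append[of cs ds] cs ds derived_set_in_carrier[of "carrier G"] by auto
  moreover have "length (cs @ ds) = comm_length G g + comm_length G h"
    "set (cs @ ds) \<subseteq> derived_set G (carrier G)"
    using cs ds by auto
  ultimately show ?thesis
    unfolding comm_length_def[of G "g \<otimes> h"] by (intro Least_le) blast
qed

lemma commutator_subgroup_pow_closed:
  assumes "g \<in> commutator_subgroup G"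
  shows "g [^] (n::nat) \<in> commutator_subgroup G"
proof -
  interpret D: subgroup "commutator_subgroup G" G
    by (rule derived_is_subgroup) simp
  show ?thesis
    using assms by (induction n) auto
qed

lemma scl_derived_LIMSEQ:
  assumes "g \<in> commutator_subgroup G"
  shows "(\<lambda>m. real (comm_length G (g [^] m)) / real m) \<longlonglongrightarrow> scl_derived G g"
proof -
  have g: "g \<in> carrier G"
    using assms derived_in_carrier[of "carrier G"] by blast
  have "comm_length G (g [^] (m + n)) \<le> comm_length G (g [^] m) + comm_length G (g [^] n)"
    for m n :: nat
    using comm_length_mult_le[of "g [^] m" "g [^] n"] assms g
    by (simp add: commutator_subgroup_pow_closed nat_pow_mult)
  then have "convergent (\<lambda>m. real (comm_length G (g [^] m)) / real m)"
    by (intro subadditive_convergent) (auto simp flip: of_nat_add)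
  then show ?thesis
    unfolding scl_derived_def by (simp add: convergent_LIMSEQ_iff)
qed

lemma scl_derived_pow:
  assumes "g \<in> commutator_subgroup G" "0 < k"
  shows "scl_derived G (g [^] (k::nat)) = real k * scl_derived G g"
proof -
  have g: "g \<in> carrier G"
    using assms derived_in_carrier[of "carrier G"] by blast
  have "strict_mono (\<lambda>m. k * m)"
    using assms by (simp add: strict_mono_def)
  from LIMSEQ_subseq_LIMSEQ[OF scl_derived_LIMSEQ[OF assms(1)] this]
  have "(\<lambda>m. real k * (real (comm_length G (g [^] (k * m))) / real (k * m)))
          \<longlonglongrightarrow> real k * scl_derived G g"
    by (intro tendsto_mult_left) (simp add: o_def)
  moreover have "real k * (real (comm_length G (g [^] (k * m))) / real (k * m)) =
      real (comm_length G ((g [^] k) [^] m)) / real m" for m :: nat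
    using assms g by (simp add: nat_pow_pow)
  ultimately have "(\<lambda>m. real (comm_length G ((g [^] k) [^] m)) / real m)
      \<longlonglongrightarrow> real k * scl_derived G g"
    by simp
  then show ?thesis
    using scl_derived_LIMSEQ[OF commutator_subgroup_pow_closed[OF assms(1)]] LIMSEQ_unique by blast
qed

lemma scl_eq:
  assumes g: "g \<in> carrier G" and "0 < n" "g [^] (n::nat) \<in> commutator_subgroup G"
  shows "scl G g = scl_derived G (g [^] n) / real n"
proof -
  define m where "m = (LEAST m::nat. 0 < m \<and> g [^] m \<in> commutator_subgroup G)"
  have m: "0 < m \<and> g [^] m \<in> commutator_subgroup G"
    unfolding m_def by (rule LeastI[of _ n]) (use assms in auto)
  have "real n * scl_derived G (g [^] m) = scl_derived G (g [^] (m * n))"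
    using scl_derived_pow[of "g [^] m" n] m assms by (simp add: nat_pow_pow)
  also have "\<dots> = real m * scl_derived G (g [^] n)"
    using scl_derived_pow[of "g [^] n" m] m assms by (simp add: nat_pow_pow mult.commute)
  finally show ?thesis
    using m assms by (simp add: scl_def Let_def field_simps flip: m_def)
qed

end


section \<open>Random walk\<close>

text \<open>
  The steps are indexed from 0, so the position at time \<open>n\<close> is the product, from left to right,
  of the steps \<open>s 0, \<dots>, s (n - 1)\<close>.
\<close>

primrec walk :: "('a, 'b) monoid_scheme \<Rightarrow> (nat \<Rightarrow> 'w \<Rightarrow> 'a) \<Rightarrow> nat \<Rightarrow> 'w \<Rightarrow> 'a" where
  "walk G s 0 \<omega> = \<one>\<^bsub>G\<^esub>"
| "walk G s (Suc n) \<omega> = walk G s n \<omega> \<otimes>\<^bsub>G\<^esub> s n \<omega>"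

end

theory Submission
  imports Defs
begin

text \<open>
  Up to constants, \<open>scl\<close> is the maximum of finitely many homogeneous quasimorphisms, and a nonzero
  homogeneous quasimorphism has order exactly \<open>\<surd>n\<close> along the walk.

  The first half is Bavard duality with nonoptimal constants. A homogeneous quasimorphism of
  defect \<open>D\<close> is at most \<open>3D\<close> on commutators, so \<open>\<bar>\<phi>\<bar> \<le> 4 D \<cdot> scl\<close>
  (\<open>homogeneous_quasimorphism_le_scl\<close>). Conversely, consider chains, that is, elements of the free
  abelian group on \<open>G\<close>, and measure a chain by the length of the relations of \<open>G\<close> whose abelianization
  is a multiple of it. This filling norm dominates \<open>scl\<close>, because rearranging a word costs at most one
  commutator for each letter, and a linear functional below it is a quasimorphism of bounded defect. The
  Hahn--Banach theorem for abelian groups provides the functional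
  (\<open>scl_le_homogeneous_quasimorphism\<close>). If the space of homogeneous quasimorphisms is
  finite-dimensional, its members are interpolated linearly from their values at finitely many
  points, and the easy half of the duality, applied at these points, bounds the coefficients. So
  \<open>scl\<close> is at most a constant plus a multiple of \<open>\<Sum>\<bar>\<psi>\<bar>\<close> over a finite family of quasimorphisms
  (\<open>scl_le_sum_quasimorphisms\<close>).

  For the second half, a homogeneous quasimorphism is at bounded distance from a function that is harmonic
  for the walk (\<open>harmonic_representative\<close>). Along the walk this function is a martingale with bounded
  increments, which gives the upper bounds \<open>O(n)\<close> and \<open>O(n\<^sup>2)\<close> on the second and fourth moments.
  The variance also grows at least linearly, because a fixed word on which the quasimorphism is large
  appears in each stretch of the walk with a fixed positive probability
  (\<open>quasimorphism_variance_ge\<close>).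

  The upper bound for \<open>scl\<close> is then Markov's inequality. For the lower bound,
  cut the walk into a fixed number of blocks. The value of the quasimorphism is the sum of its
  values on the blocks up to a bounded error, these are independent with a common symmetric
  distribution, and the moment bounds keep their characteristic function away from 1 at frequencies of order
  \<open>n\<^sup>-\<^sup>1\<^sup>/\<^sup>2\<close>. With many blocks the characteristic function of the sum is small there, and a Fejer
  kernel turns this into a bound on the probability of an interval around zero
  (\<open>quasimorphism_anticoncentration\<close>).
\<close>

section \<open>Hahn--Banach for abelian groups\<close>

abbreviation nat_multiple :: "nat \<Rightarrow> 'a \<Rightarrow> 'a::comm_monoid_add" where
  "nat_multiple n x \<equiv> \<Sum>i<n. x"

lemma nat_multiple_add: "nat_multiple (m + n) x = nat_multiple m x + nat_multiple n x"
  by (induction n) (auto simp: add.assoc)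

lemma nat_multiple_mult: "nat_multiple (m * n) x = nat_multiple m (nat_multiple n x)"
  by (induction m) (auto simp: nat_multiple_add ac_simps)

definition sublinear :: "('a::ab_group_add \<Rightarrow> real) \<Rightarrow> bool" where
  "sublinear p \<longleftrightarrow>
     (\<forall>x y. p (x + y) \<le> p x + p y) \<and> (\<forall>n x. p (nat_multiple n x) = real n * p x)"

lemma sublinearD:
  assumes "sublinear p"
  shows "p (x + y) \<le> p x + p y" "p (nat_multiple n x) = real n * p x" "p 0 = 0" "- p (- x) \<le> p x"
proof -
  show 1: "p (x + y) \<le> p x + p y" "p (nat_multiple n x) = real n * p x" for x y n
    using assms by (auto simp: sublinear_def)
  show 0: "p 0 = 0"
    using 1(2)[of 0 0] by simp
  show "- p (- x) \<le> p x"
    using 1(1)[of x "- x"] 0 by simp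
qed

text \<open>
  The infimum of a chain of sublinear functionals is sublinear: for two members, the smaller one
  serves both arguments in the subadditivity estimate.
\<close>

lemma sublinear_INF_chain:
  fixes C :: "('a::ab_group_add \<Rightarrow> real) set"
  assumes ne: "C \<noteq> {}" and sub: "\<And>q. q \<in> C \<Longrightarrow> sublinear q \<and> q \<le> p"
    and chain: "\<And>q r. q \<in> C \<Longrightarrow> r \<in> C \<Longrightarrow> q \<le> r \<or> r \<le> q"
  shows "sublinear (\<lambda>x. INF q\<in>C. q x)" "q \<in> C \<Longrightarrow> (INF q\<in>C. q x) \<le> q x"
proof -
  have bdd: "bdd_below ((\<lambda>q. q x) ` C)" for x
  proof (rule bdd_belowI2)
    fix q assume "q \<in> C"
    then have "- q (- x) \<le> q x" "q (- x) \<le> p (- x)"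
      using sub[of q] sublinearD(4)[of q x] by (auto simp: le_fun_def)
    then show "- p (- x) \<le> q x" by linarith
  qed
  show lower: "(INF q\<in>C. q x) \<le> q x" if "q \<in> C" for q x
    using that by (intro cINF_lower bdd)
  show "sublinear (\<lambda>x. INF q\<in>C. q x)"
    unfolding sublinear_def
  proof (intro conjI allI)
    fix x y
    have "(INF q\<in>C. q (x + y)) - r y \<le> q x" if qr: "q \<in> C" "r \<in> C" for q r
    proof -
      obtain s where s: "s \<in> C" "s \<le> q" "s \<le> r"
        using chain[OF qr] qr by blast
      have "(INF q\<in>C. q (x + y)) \<le> s (x + y)"
        using s by (intro lower)
      also have "\<dots> \<le> s x + s y"
        using sub s sublinearD(1) by blast
      also have "\<dots> \<le> q x + r y"
        using s by (intro add_mono) (auto simp: le_fun_def)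
      finally show ?thesis by simp
    qed
    then have "(INF q\<in>C. q (x + y)) - (INF q\<in>C. q x) \<le> r y" if "r \<in> C" for r
      using that cINF_greatest[OF ne, of "(INF q\<in>C. q (x + y)) - r y" "\<lambda>q. q x"] by force
    then have "(INF q\<in>C. q (x + y)) - (INF q\<in>C. q x) \<le> (INF q\<in>C. q y)"
      by (intro cINF_greatest[OF ne])
    then show "(INF q\<in>C. q (x + y)) \<le> (INF q\<in>C. q x) + (INF q\<in>C. q y)" by simp
  next
    fix n :: nat and x
    have eq: "(INF q\<in>C. q (nat_multiple n x)) = (INF q\<in>C. real n * q x)"
      using sub by (intro INF_cong) (auto simp: sublinearD)
    show "(INF q\<in>C. q (nat_multiple n x)) = real n * (INF q\<in>C. q x)"
    proof (cases "n = 0")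
      case False
      have "(INF q\<in>C. real n * q x) \<le> real n * q x" if "q \<in> C" for q
        using lower[OF that, of "nat_multiple n x"] sub[OF that] unfolding eq
        by (simp only: sublinearD)
      then have "(INF q\<in>C. real n * q x) / real n \<le> (INF q\<in>C. q x)"
        using False by (intro cINF_greatest[OF ne]) (simp add: field_simps)
      moreover have "real n * (INF q\<in>C. q x) \<le> (INF q\<in>C. real n * q x)"
        using lower by (intro cINF_greatest[OF ne] mult_left_mono) auto
      ultimately show ?thesis
        using False unfolding eq by (simp add: field_simps)
    qed (use ne eq in auto)
  qed
qed

text \<open>
  The reduction step of Hahn--Banach: below \<open>p\<close> lies a sublinear functional whose value at \<open>y\<close>
  is at most \<open>p (y + x) - p x\<close>. So a minimal sublinear functional is superadditive, thus additive.
\<close>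

lemma sublinear_shift:
  fixes p :: "'a::ab_group_add \<Rightarrow> real"
  assumes p: "sublinear p"
  obtains q where "sublinear q" "q \<le> p" "\<And>y. q y \<le> p (y + x) - p x"
proof -
  define f where "f y n = p (y + nat_multiple n x) - real n * p x" for y n
  define q where "q y = (INF n. f y n)" for y
  have bdd: "bdd_below (range (f y))" for y
  proof (rule bdd_belowI2)
    fix n
    have "real n * p x \<le> p (y + nat_multiple n x) + p (- y)"
      using sublinearD(1)[OF p, of "y + nat_multiple n x" "- y"] sublinearD(2)[OF p, of x n] by simp
    then show "- p (- y) \<le> f y n" by (simp add: f_def)
  qed
  have lower: "q y \<le> f y n" for y n
    unfolding q_def by (rule cINF_lower[OF bdd]) simp
  have greatest: "c \<le> q y" if "\<And>n. c \<le> f y n" for c y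
    unfolding q_def by (rule cINF_greatest) (use that in auto)
  have dec: "f y (n + k) \<le> f y n" for y n k
    using sublinearD(1)[OF p, of "y + nat_multiple n x" "nat_multiple k x"] sublinearD(2)[OF p, of x k]
    by (simp add: f_def nat_multiple_add add.assoc algebra_simps)
  have "sublinear q"
    unfolding sublinear_def
  proof (intro conjI allI)
    fix y z
    have "q (y + z) \<le> f y m + f z n" for m n
    proof -
      have "f (y + z) (m + n) \<le> f y m + f z n"
        using sublinearD(1)[OF p, of "y + nat_multiple m x" "z + nat_multiple n x"]
        by (simp add: f_def nat_multiple_add algebra_simps)
      then show ?thesis using lower[of "y + z" "m + n"] by simp
    qed
    then have "q (y + z) - f z n \<le> q y" for n
      by (intro greatest) (simp add: algebra_simps)
    then have "q (y + z) - q y \<le> q z"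
      by (intro greatest) (simp add: algebra_simps)
    then show "q (y + z) \<le> q y + q z" by simp
  next
    fix k y
    have scale: "f (nat_multiple k y) (k * n) = real k * f y n" for n
      using sublinearD(2)[OF p, of "y + nat_multiple n x" k]
      by (simp add: f_def nat_multiple_mult sum.distrib algebra_simps)
    show "q (nat_multiple k y) = real k * q y"
    proof (cases "k = 0")
      case True
      have "f 0 n = 0" for n
        using sublinearD(2)[OF p, of x n] by (simp add: f_def)
      then show ?thesis using True by (simp add: q_def)
    next
      case False
      have "real k * q y \<le> f (nat_multiple k y) n" for n
      proof -
        have "real k * q y \<le> f (nat_multiple k y) (k * n)"
          using lower[of y n] by (simp add: scale mult_left_mono)
        also have "k * n = n + (k - 1) * n"
          using False by (cases k) auto
        also have "f (nat_multiple k y) (n + (k - 1) * n) \<le> f (nat_multiple k y) n"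
          by (rule dec)
        finally show ?thesis .
      qed
      then have "real k * q y \<le> q (nat_multiple k y)"
        by (rule greatest)
      moreover have "q (nat_multiple k y) / real k \<le> q y"
        using lower[of "nat_multiple k y" "k * _"] False unfolding scale
        by (intro greatest) (simp add: field_simps)
      ultimately show ?thesis
        using False by (simp add: field_simps)
    qed
  qed
  moreover have "q \<le> p"
    using lower[of _ 0] by (simp add: le_fun_def f_def)
  moreover have "q y \<le> p (y + x) - p x" for y
    using lower[of y 1] by (simp add: f_def)
  ultimately show ?thesis using that by blast
qed

text \<open>
  Among the sublinear functionals below the shift of \<open>p\<close> at \<open>a\<close>, a minimal one exists by Zorn's
  lemma. It is additive, and its value at \<open>- a\<close> is at most \<open>p 0 - p a\<close>, which forces equality at \<open>a\<close>.
\<close>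

theorem Hahn_Banach_abelian_group:
  fixes p :: "'a::ab_group_add \<Rightarrow> real"
  assumes p: "sublinear p"
  obtains l where "\<And>x y. l (x + y) = l x + l y" "\<And>x. l x \<le> p x" "l a = p a"
proof -
  obtain p' where p': "sublinear p'" "p' \<le> p" "\<And>y. p' y \<le> p (y + a) - p a"
    using sublinear_shift[OF p, of a] by blast
  define A where "A = {q. sublinear q \<and> q \<le> p'}"
  have "\<exists>m\<in>A. \<forall>q\<in>A. q \<le> m \<longrightarrow> q = m"
  proof (rule predicate_Zorn)
    show "partial_order_on A (relation_of (\<lambda>x y. y \<le> x) A)"
      by (rule partial_order_on_relation_ofI) auto
  next
    fix C assume C: "C \<in> Chains (relation_of (\<lambda>x y. y \<le> x) A)"
    show "\<exists>u\<in>A. \<forall>q\<in>C. u \<le> q"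
    proof (cases "C = {}")
      case True
      then show ?thesis using p' by (auto simp: A_def)
    next
      case False
      have sub: "sublinear q \<and> q \<le> p'" if "q \<in> C" for q
        using that C by (auto simp: Chains_def relation_of_def A_def)
      have chain: "q \<le> r \<or> r \<le> q" if "q \<in> C" "r \<in> C" for q r
        using that C by (auto simp: Chains_def relation_of_def)
      define u where "u x = (INF q\<in>C. q x)" for x
      have u: "sublinear u" "\<And>q. q \<in> C \<Longrightarrow> u \<le> q"
        using sublinear_INF_chain[OF False sub chain] unfolding u_def[abs_def] by (auto simp: le_fun_def)
      moreover have "u \<le> p'"
        using False u sub by (meson all_not_in_conv order_trans)
      ultimately show ?thesis by (auto simp: A_def)
    qed
  qed
  then obtain l where l: "sublinear l" "l \<le> p'" and min: "\<And>q. sublinear q \<Longrightarrow> q \<le> l \<Longrightarrow> q = l"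
    unfolding A_def by (auto intro: order_trans)
  have super: "l y + l x \<le> l (y + x)" for x y
    using sublinear_shift[OF l(1), of x] min by (metis le_diff_eq)
  have add: "l (x + y) = l x + l y" for x y
    using super[of x y] sublinearD(1)[OF l(1), of x y] by simp
  have "l a + l (- a) = 0"
    using add[of a "- a"] sublinearD(3)[OF l(1)] by simp
  moreover have "l (- a) \<le> - p a"
    using l(2) p'(3)[of "- a"] sublinearD(3)[OF p] by (auto simp: le_fun_def intro: order_trans)
  moreover have "l x \<le> p x" for x
    using l(2) p'(2) by (auto simp: le_fun_def intro: order_trans)
  ultimately show ?thesis
    using that[of l] add by (metis add.commute add_le_cancel_left antisym le_minus_iff minus_unique)
qed

section \<open>Quasimorphisms\<close>

definition defect_le :: "('a, 'b) monoid_scheme \<Rightarrow> ('a \<Rightarrow> real) \<Rightarrow> real \<Rightarrow> bool" where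
  "defect_le G \<phi> D \<longleftrightarrow> (\<forall>g\<in>carrier G. \<forall>h\<in>carrier G. \<bar>\<phi> (g \<otimes>\<^bsub>G\<^esub> h) - \<phi> g - \<phi> h\<bar> \<le> D)"

lemma defect_leD:
  assumes "defect_le G \<phi> D" "g \<in> carrier G" "h \<in> carrier G"
  shows "\<bar>\<phi> (g \<otimes>\<^bsub>G\<^esub> h) - \<phi> g - \<phi> h\<bar> \<le> D"
  using assms by (auto simp: defect_le_def)

lemma homogeneous_quasimorphism_defect:
  assumes "\<phi> \<in> homogeneous_quasimorphisms G"
  obtains D where "defect_le G \<phi> D"
  using assms by (auto simp: homogeneous_quasimorphisms_def quasimorphism_iff defect_le_def)

context group
begin

lemma defect_le_nonneg:
  assumes "defect_le G \<phi> D"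
  shows "0 \<le> D"
  using defect_leD[OF assms, of \<one> \<one>] by fastforce

lemma homogeneous_quasimorphism_pow:
  assumes "\<phi> \<in> homogeneous_quasimorphisms G" "g \<in> carrier G"
  shows "\<phi> (g [^] (n::nat)) = real n * \<phi> g" "\<phi> (inv g) = - \<phi> g" "\<phi> \<one> = 0"
proof -
  have hom: "\<phi> (g [^] m) = of_int m * \<phi> g" for m :: int
    using assms by (auto simp: homogeneous_quasimorphisms_def)
  show "\<phi> (g [^] n) = real n * \<phi> g"
    using hom[of "int n"] by (simp add: int_pow_int)
  show "\<phi> (inv g) = - \<phi> g"
    using hom[of "- 1"] assms(2) by (simp add: int_pow_neg int_pow_1)
  show "\<phi> \<one> = 0"
    using hom[of 0] by simp
qed

lemma defect_le_pow:
  assumes "defect_le G \<phi> D" "g \<in> carrier G" "0 < n"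
  shows "\<bar>\<phi> (g [^] (n::nat)) - real n * \<phi> g\<bar> \<le> real n * D"
  using assms(3)
proof (induction n rule: nat_induct_non_zero)
  case 1
  then show ?case
    using assms(2) defect_le_nonneg[OF assms(1)] by simp
next
  case (Suc n)
  then show ?case
    using defect_leD[OF assms(1), of "g [^] n" g] assms(2) by (simp add: algebra_simps)
qed

text \<open>
  The homogenization is the limit of \<open>\<phi> (g\<^sup>n) / n\<close>; along the powers of two
  the differences of successive terms form a geometric series.
\<close>

lemma homogenization:
  assumes \<phi>: "defect_le G \<phi> D"
  obtains \<psi> where "\<psi> \<in> homogeneous_quasimorphisms G" "defect_le G \<psi> (4 * D)"
    "\<And>g. g \<in> carrier G \<Longrightarrow> \<bar>\<psi> g - \<phi> g\<bar> \<le> D"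
proof -
  define a where "a g k = \<phi> (g [^] (2 ^ k :: nat)) / 2 ^ k" for g k
  define e where "e k = D * (1/2) ^ Suc k" for k
  have D: "0 \<le> D" by (rule defect_le_nonneg[OF \<phi>])
  have step: "\<bar>a g (Suc k) - a g k\<bar> \<le> e k" if g: "g \<in> carrier G" for g k
  proof -
    have "g [^] (2 ^ Suc k :: nat) = g [^] (2 ^ k :: nat) \<otimes> g [^] (2 ^ k :: nat)"
      using g by (subst nat_pow_mult) (auto intro!: arg_cong[of _ _ "\<lambda>n. g [^] n"])
    then have "\<bar>\<phi> (g [^] (2 ^ Suc k :: nat)) - \<phi> (g [^] (2 ^ k :: nat)) - \<phi> (g [^] (2 ^ k :: nat))\<bar> \<le> D"
      using g defect_leD[OF \<phi>, of "g [^] (2 ^ k :: nat)" "g [^] (2 ^ k :: nat)"] by (simp del: power_Suc)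
    then have "\<bar>\<phi> (g [^] (2 ^ Suc k :: nat)) - 2 * \<phi> (g [^] (2 ^ k :: nat))\<bar> / 2 ^ Suc k \<le> D / 2 ^ Suc k"
      by (intro divide_right_mono) (simp_all del: power_Suc)
    also have "\<bar>\<phi> (g [^] (2 ^ Suc k :: nat)) - 2 * \<phi> (g [^] (2 ^ k :: nat))\<bar> / 2 ^ Suc k =
        \<bar>(\<phi> (g [^] (2 ^ Suc k :: nat)) - 2 * \<phi> (g [^] (2 ^ k :: nat))) / 2 ^ Suc k\<bar>"
      by (simp add: abs_divide del: power_Suc)
    also have "(\<phi> (g [^] (2 ^ Suc k :: nat)) - 2 * \<phi> (g [^] (2 ^ k :: nat))) / 2 ^ Suc k = a g (Suc k) - a g k"
      by (simp add: a_def diff_divide_distrib)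
    finally show ?thesis by (simp only: e_def power_one_over times_divide_eq_right mult_1_right)
  qed
  define \<psi>0 where "\<psi>0 g = a g 0 + suminf (\<lambda>k. a g (Suc k) - a g k)" for g
  define \<psi> where "\<psi> g = (if g \<in> carrier G then \<psi>0 g else 0)" for g
  have geo: "e sums D"
    using sums_mult[OF power_half_series, of D] unfolding e_def[abs_def] mult_1_right .
  have lim: "a g \<longlonglongrightarrow> \<psi> g" and close: "\<bar>\<psi> g - \<phi> g\<bar> \<le> D" if g: "g \<in> carrier G" for g
  proof -
    have summ: "summable (\<lambda>k. norm (a g (Suc k) - a g k))"
      by (rule summable_comparison_test'[OF sums_summable[OF geo], of 0]) (simp add: step[OF g])
    have "(\<lambda>k. a g (Suc k) - a g k) sums (\<psi>0 g - a g 0)"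
      using summable_sums[OF summable_norm_cancel[OF summ]] by (simp add: \<psi>0_def)
    from sums_def[THEN iffD1, OF this] have "(\<lambda>n. a g n - a g 0) \<longlonglongrightarrow> \<psi>0 g - a g 0"
      by (simp add: sum_lessThan_telescope)
    from tendsto_add[OF this tendsto_const[of "a g 0"]] show "a g \<longlonglongrightarrow> \<psi> g"
      using g by (simp add: \<psi>_def)
    have "\<bar>suminf (\<lambda>k. a g (Suc k) - a g k)\<bar> \<le> suminf (\<lambda>k. norm (a g (Suc k) - a g k))"
      using summable_norm[OF summ] by simp
    also have "\<dots> \<le> suminf e"
      using step[OF g] by (intro suminf_le summ sums_summable[OF geo]) simp
    also have "\<dots> = D"
      using geo by (simp add: sums_iff)
    finally show "\<bar>\<psi> g - \<phi> g\<bar> \<le> D"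
      using g by (simp add: \<psi>_def \<psi>0_def a_def)
  qed
  have defect: "defect_le G \<psi> (4 * D)"
    unfolding defect_le_def
  proof (intro ballI)
    fix g h assume "g \<in> carrier G" "h \<in> carrier G"
    then show "\<bar>\<psi> (g \<otimes> h) - \<psi> g - \<psi> h\<bar> \<le> 4 * D"
      using close[of g] close[of h] close[of "g \<otimes> h"] defect_leD[OF \<phi>, of g h] by force
  qed
  have null: "(\<lambda>k. c / 2 ^ k) \<longlonglongrightarrow> 0" for c :: real
    using tendsto_mult_right_zero[OF LIMSEQ_power_zero[of "1/2 :: real"], of c] by (simp add: power_one_over)
  have pow: "\<psi> (g [^] (m::nat)) = real m * \<psi> g" if g: "g \<in> carrier G" for g m
  proof (cases "m = 0")
    case True
    have "a \<one> = (\<lambda>k. \<phi> \<one> / 2 ^ k)"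
      by (auto simp: a_def)
    then have "\<psi> \<one> = 0"
      using lim[of \<one>] null[of "\<phi> \<one>"] LIMSEQ_unique by fastforce
    then show ?thesis using True by simp
  next
    case False
    have "(\<lambda>k. a (g [^] m) k - real m * a g k) \<longlonglongrightarrow> \<psi> (g [^] m) - real m * \<psi> g"
      using g by (intro tendsto_diff tendsto_mult_left lim) auto
    moreover have "(\<lambda>k. a (g [^] m) k - real m * a g k) \<longlonglongrightarrow> 0"
    proof (rule Lim_null_comparison[OF always_eventually null, rule_format])
      fix k
      have "\<bar>\<phi> ((g [^] (2 ^ k :: nat)) [^] m) - real m * \<phi> (g [^] (2 ^ k :: nat))\<bar> / 2 ^ k \<le> real m * D / 2 ^ k"
        using g False by (intro divide_right_mono defect_le_pow[OF \<phi>]) auto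
      then show "norm (a (g [^] m) k - real m * a g k) \<le> real m * D / 2 ^ k"
        using g by (simp add: a_def nat_pow_pow mult.commute diff_divide_distrib[symmetric] abs_divide)
    qed
    ultimately show ?thesis
      using LIMSEQ_unique by fastforce
  qed
  have inv: "\<psi> (inv g) = - \<psi> g" if g: "g \<in> carrier G" for g
  proof -
    have "\<bar>\<psi> g + \<psi> (inv g)\<bar> \<le> 4 * D / real (Suc n)" for n
    proof -
      have "\<psi> \<one> = 0" using pow[of \<one> 0] by simp
      moreover have "g [^] Suc n \<otimes> inv g [^] Suc n = \<one>"
        using g nat_pow_closed r_inv nat_pow_inv by metis
      ultimately have "\<bar>\<psi> (g [^] Suc n) + \<psi> (inv g [^] Suc n)\<bar> \<le> 4 * D"
        using defect_leD[OF defect, of "g [^] Suc n" "inv g [^] Suc n"] g by (simp del: nat_pow_Suc)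
      then have "real (Suc n) * \<bar>\<psi> g + \<psi> (inv g)\<bar> \<le> 4 * D"
        using pow[OF g, of "Suc n"] pow[of "inv g" "Suc n"] g
        by (simp del: nat_pow_Suc of_nat_Suc add: abs_mult flip: distrib_left)
      then show ?thesis by (simp add: field_simps)
    qed
    then have "\<bar>\<psi> g + \<psi> (inv g)\<bar> \<le> 0"
      by (intro LIMSEQ_le_const[OF lim_const_over_n[THEN LIMSEQ_Suc, of "4 * D"]]) auto
    then show ?thesis by simp
  qed
  have "\<psi> (g [^] m) = of_int m * \<psi> g" if "g \<in> carrier G" for g and m :: int
    using that by (cases m rule: int_cases2) (auto simp: int_pow_int int_pow_neg pow inv)
  then have "\<psi> \<in> homogeneous_quasimorphisms G"
    using defect by (auto simp: homogeneous_quasimorphisms_def quasimorphism_iff defect_le_def \<psi>_def)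
  then show ?thesis using that defect close by blast
qed

end

section \<open>Bavard duality\<close>

context group
begin

lemma homogeneous_quasimorphism_commutator:
  assumes \<phi>: "\<phi> \<in> homogeneous_quasimorphisms G" "defect_le G \<phi> D"
    and c: "c \<in> derived_set G (carrier G)"
  shows "\<bar>\<phi> c\<bar> \<le> 3 * D"
proof -
  obtain x y where xy: "x \<in> carrier G" "y \<in> carrier G" "c = x \<otimes> y \<otimes> inv x \<otimes> inv y"
    using c by blast
  then show ?thesis
    using defect_leD[OF \<phi>(2), of x y] defect_leD[OF \<phi>(2), of "x \<otimes> y" "inv x"]
      defect_leD[OF \<phi>(2), of "x \<otimes> y \<otimes> inv x" "inv y"]
      homogeneous_quasimorphism_pow(2)[OF \<phi>(1), of x] homogeneous_quasimorphism_pow(2)[OF \<phi>(1), of y]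
    by (simp add: abs_le_iff)
qed

lemma homogeneous_quasimorphism_le_comm_length:
  assumes \<phi>: "\<phi> \<in> homogeneous_quasimorphisms G" "defect_le G \<phi> D"
    and g: "g \<in> commutator_subgroup G"
  shows "\<bar>\<phi> g\<bar> \<le> 4 * D * real (comm_length G g)"
proof -
  have bound: "\<bar>\<phi> (foldr (mult G) cs \<one>)\<bar> \<le> 4 * D * real (length cs)" if "set cs \<subseteq> derived_set G (carrier G)" for cs
    using that
  proof (induction cs)
    case Nil
    then show ?case using homogeneous_quasimorphism_pow(3)[OF \<phi>(1) one_closed] by simp
  next
    case (Cons c cs)
    have "set (c # cs) \<subseteq> carrier G"
      using Cons.prems derived_set_in_carrier by blast
    then have "c \<in> carrier G" "foldr (mult G) cs \<one> \<in> carrier G"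
      using foldr_mult_append[of "[]" cs] by auto
    then have "\<bar>\<phi> (c \<otimes> foldr (mult G) cs \<one>) - \<phi> c - \<phi> (foldr (mult G) cs \<one>)\<bar> \<le> D"
      by (rule defect_leD[OF \<phi>(2)])
    moreover have "\<bar>\<phi> c\<bar> \<le> 3 * D"
      using Cons.prems by (intro homogeneous_quasimorphism_commutator[OF \<phi>]) auto
    ultimately show ?case
      using Cons by (simp add: algebra_simps)
  qed
  obtain cs where cs: "length cs = comm_length G g" "set cs \<subseteq> derived_set G (carrier G)"
    "g = foldr (mult G) cs \<one>"
    using comm_length_witness[OF g] .
  show ?thesis
    using bound[OF cs(2)] unfolding cs(1) cs(3)[symmetric] .
qed

text \<open>
  The easy half of Bavard duality: the bound by the commutator length is applied to the powers
  of an element, on which a homogeneous quasimorphism grows linearly.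
\<close>

lemma homogeneous_quasimorphism_le_scl:
  assumes \<phi>: "\<phi> \<in> homogeneous_quasimorphisms G" "defect_le G \<phi> D"
    and g: "g \<in> carrier G" and n: "0 < n" "g [^] (n::nat) \<in> commutator_subgroup G"
  shows "\<bar>\<phi> g\<bar> \<le> 4 * D * scl G g"
proof -
  let ?h = "g [^] n"
  have h: "?h \<in> carrier G" using g by simp
  have "\<bar>\<phi> ?h\<bar> \<le> 4 * D * scl_derived G ?h"
  proof (rule LIMSEQ_le_const[OF tendsto_mult_left[OF scl_derived_LIMSEQ[OF n(2)]]])
    have "\<bar>\<phi> ?h\<bar> \<le> 4 * D * (real (comm_length G (?h [^] m)) / real m)" if "1 \<le> m" for m :: nat
      using homogeneous_quasimorphism_le_comm_length[OF \<phi> commutator_subgroup_pow_closed[OF n(2)], of m]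
        homogeneous_quasimorphism_pow(1)[OF \<phi>(1) h, of m] that
      by (simp add: abs_mult field_simps)
    then show "\<exists>N. \<forall>m\<ge>N. \<bar>\<phi> ?h\<bar> \<le> 4 * D * (real (comm_length G (?h [^] m)) / real m)" by blast
  qed
  moreover have "scl_derived G ?h = real n * scl G g"
    using n(1) by (simp add: scl_eq[OF g n])
  ultimately have "real n * \<bar>\<phi> g\<bar> \<le> real n * (4 * D * scl G g)"
    using homogeneous_quasimorphism_pow(1)[OF \<phi>(1) g, of n] by (simp add: abs_mult ac_simps)
  then show ?thesis
    using n(1) by simp
qed

lemma scl_nonneg:
  assumes "g \<in> carrier G" "0 < n" "g [^] (n::nat) \<in> commutator_subgroup G"
  shows "0 \<le> scl G g"
proof -
  have "0 \<le> scl_derived G (g [^] n)"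
    by (rule LIMSEQ_le_const[OF scl_derived_LIMSEQ[OF assms(3)]]) auto
  then show ?thesis by (simp add: scl_eq[OF assms])
qed

lemma scl_le_comm_length:
  assumes g: "g \<in> carrier G" and n: "0 < n" "g [^] (n::nat) \<in> commutator_subgroup G"
  shows "scl G g \<le> real (comm_length G (g [^] n)) / real n"
proof -
  let ?h = "g [^] n"
  have "comm_length G (?h [^] m) \<le> m * comm_length G ?h" if "1 \<le> m" for m :: nat
    using that
  proof (induction m rule: nat_induct_at_least)
    case base
    then show ?case using g by simp
  next
    case (Suc m)
    then show ?case
      using comm_length_mult_le[OF commutator_subgroup_pow_closed[OF n(2)] n(2), of m] by simp
  qed
  then have "real (comm_length G (?h [^] m)) / real m \<le> real (comm_length G ?h)" if "1 \<le> m" for m :: nat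
    using that by (simp add: field_simps flip: of_nat_mult)
  then have "scl_derived G ?h \<le> real (comm_length G ?h)"
    by (intro LIMSEQ_le_const2[OF scl_derived_LIMSEQ[OF n(2)]]) blast
  then show ?thesis
    using n by (simp add: scl_eq[OF g n] divide_right_mono)
qed

text \<open>
  A word is a list over the type of group elements; a letter outside the carrier is read as the
  identity, which makes words over the whole type available as representatives of 1-chains.
\<close>

definition letter :: "'a \<Rightarrow> 'a" where
  "letter x = (if x \<in> carrier G then x else \<one>)"

definition word :: "'a list \<Rightarrow> 'a" where
  "word w = foldr (mult G) (map letter w) \<one>"

definition chain :: "'a list \<Rightarrow> 'a \<Rightarrow>\<^sub>0 int" where
  "chain w = sum_list (map frag_of w)"

lemma letter_closed [simp]: "letter x \<in> carrier G"
  by (simp add: letter_def)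

lemma word_simps [simp]: "word [] = \<one>" "word (x # w) = letter x \<otimes> word w"
  by (simp_all add: word_def)

lemma word_closed [simp]: "word w \<in> carrier G"
  by (induction w) auto

lemma word_append [simp]: "word (u @ v) = word u \<otimes> word v"
  by (induction u) (auto simp: m_assoc)

lemma chain_simps [simp]: "chain [] = 0" "chain (x # w) = frag_of x + chain w"
  "chain (u @ v) = chain u + chain v"
  by (simp_all add: chain_def)

lemma word_replicate: "word (concat (replicate n w)) = word w [^] n"
proof (induction n)
  case (Suc n)
  have "word w \<otimes> word w [^] n = word w [^] Suc n"
    by (rule nat_pow_Suc2[symmetric]) simp
  then show ?case using Suc by simp
qed simp

lemma chain_replicate: "chain (concat (replicate n w)) = nat_multiple n (chain w)"
  by (induction n) (auto simp: add.commute)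

lemma lookup_chain: "Poly_Mapping.lookup (chain w) x = int (count (mset w) x)"
  by (induction w) (auto simp: lookup_add)

lemma chain_eq_iff: "chain u = chain v \<longleftrightarrow> mset u = mset v"
proof
  assume "chain u = chain v"
  then have "int (count (mset u) x) = int (count (mset v) x)" for x
    by (simp flip: lookup_chain)
  then show "mset u = mset v"
    by (intro multiset_eqI) simp
next
  show "mset u = mset v \<Longrightarrow> chain u = chain v"
    unfolding chain_def by (metis mset_map sum_mset_sum_list)
qed

text \<open>
  Moving one letter to the front of a word costs one commutator, since
  \<open>a x b = x a b \<cdot> b\<^sup>-\<^sup>1 [a\<^sup>-\<^sup>1, x\<^sup>-\<^sup>1] b\<close>.
\<close>

lemma word_rearrange:
  assumes "mset u = mset v"
  shows "\<exists>cs. length cs \<le> length u \<and> set cs \<subseteq> derived_set G (carrier G) \<and>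
              word v = word u \<otimes> foldr (mult G) cs \<one>"
  using assms
proof (induction u arbitrary: v)
  case (Cons x u)
  obtain a b where v: "v = a @ x # b"
    using Cons.prems by (metis list.set_intros(1) set_mset_mset split_list)
  then obtain cs where cs: "length cs \<le> length u" "set cs \<subseteq> derived_set G (carrier G)"
    "word (a @ b) = word u \<otimes> foldr (mult G) cs \<one>"
    using Cons.IH[of "a @ b"] Cons.prems by auto
  define p q r where abs_defs: "p = word a" "q = letter x" "r = word b"
  have closed: "p \<in> carrier G" "q \<in> carrier G" "r \<in> carrier G"
    by (auto simp: abs_defs)
  define c where "c = (inv r \<otimes> inv p \<otimes> r) \<otimes> (inv r \<otimes> inv q \<otimes> r) \<otimes>
      inv (inv r \<otimes> inv p \<otimes> r) \<otimes> inv (inv r \<otimes> inv q \<otimes> r)"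
  have c: "c \<in> derived_set G (carrier G)"
    unfolding c_def
    by (rule UN_I[of "inv r \<otimes> inv p \<otimes> r", OF _ UN_I[of "inv r \<otimes> inv q \<otimes> r"]]) (use closed in auto)
  have cancel: "y \<otimes> (inv y \<otimes> z) = z" "inv y \<otimes> (y \<otimes> z) = z" if "y \<in> carrier G" "z \<in> carrier G" for y z
    using that by (simp_all flip: m_assoc)
  have "p \<otimes> (q \<otimes> r) = q \<otimes> (p \<otimes> r) \<otimes> c"
    using closed by (simp add: c_def inv_mult_group m_assoc cancel)
  moreover have "foldr (mult G) cs \<one> \<in> carrier G"
    using foldr_mult_append[of "[]" cs] cs(2) derived_set_in_carrier[of "carrier G"] by auto
  moreover have "c \<in> carrier G"
    using c derived_set_in_carrier by blast
  moreover have "foldr (mult G) (cs @ [c]) \<one> = foldr (mult G) cs \<one> \<otimes> c"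
    using foldr_mult_append[of cs "[c]"] cs(2) c derived_set_in_carrier[of "carrier G"] \<open>c \<in> carrier G\<close>
    by (simp add: subset_trans[OF cs(2)])
  moreover have "word v = p \<otimes> (q \<otimes> r)" "p \<otimes> r = word u \<otimes> foldr (mult G) cs \<one>"
    using cs(3) by (simp_all add: v abs_defs)
  ultimately have "word v = word (x # u) \<otimes> foldr (mult G) (cs @ [c]) \<one>"
    using closed by (simp add: m_assoc flip: abs_defs(2))
  then show ?case
    using cs c by (intro exI[of _ "cs @ [c]"]) auto
qed auto

text \<open>
  A relation of the group is a pair of positive words with the same value, so that every
  letter counts positively; its length is the cost of filling the difference of the two chains.
\<close>

definition fillable :: "('a \<Rightarrow>\<^sub>0 int) \<Rightarrow> nat \<Rightarrow> bool" where
  "fillable a n \<longleftrightarrow> (\<exists>u v. a = chain u - chain v \<and> word u = word v \<and> length u + length v \<le> n)"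

lemma fillable_add:
  assumes "fillable a m" "fillable b n"
  shows "fillable (a + b) (m + n)"
proof -
  obtain u v u' v' where "a = chain u - chain v" "word u = word v" "length u + length v \<le> m"
    "b = chain u' - chain v'" "word u' = word v'" "length u' + length v' \<le> n"
    using assms by (auto simp: fillable_def)
  then show ?thesis
    unfolding fillable_def by (intro exI[of _ "u @ u'"] exI[of _ "v @ v'"]) auto
qed

lemma fillable_nat_multiple:
  assumes "fillable a n"
  shows "fillable (nat_multiple k a) (k * n)"
proof (induction k)
  case 0
  show ?case unfolding fillable_def by (intro exI[of _ "[]"]) auto
next
  case (Suc k)
  then show ?case using fillable_add[OF Suc assms] by (simp add: add.commute)
qed

text \<open>
  If \<open>k\<close> copies of \<open>g\<close> are filled by a relation of length \<open>n\<close>, one side of the relation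
  is a rearrangement of the other side followed by the word \<open>g\<dots>g\<close>.
\<close>

lemma fillable_comm_length:
  assumes g: "g \<in> carrier G" and fill: "fillable (nat_multiple k (frag_of g)) n"
  shows "g [^] k \<in> commutator_subgroup G" "comm_length G (g [^] k) \<le> n"
proof -
  obtain u v where uv: "nat_multiple k (frag_of g) = chain u - chain v" "word u = word v"
    "length u + length v \<le> n"
    using fill by (auto simp: fillable_def)
  have gk: "concat (replicate k [g]) = replicate k g"
    by (induction k) auto
  have "chain u = chain (v @ replicate k g)"
    using uv(1) chain_replicate[of k "[g]"] by (simp add: gk)
  then have "mset u = mset (v @ replicate k g)"
    by (simp only: chain_eq_iff)
  from word_rearrange[OF this]
  obtain cs where cs: "length cs \<le> length u" "set cs \<subseteq> derived_set G (carrier G)"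
    "word (v @ replicate k g) = word u \<otimes> foldr (mult G) cs \<one>"
    by blast
  have "word (replicate k g) = g [^] k"
    using word_replicate[of k "[g]"] g by (simp add: gk letter_def)
  moreover have c: "foldr (mult G) cs \<one> \<in> carrier G"
    using foldr_mult_append[of "[]" cs] cs(2) derived_set_in_carrier[of "carrier G"] by auto
  ultimately have eq: "g [^] k = foldr (mult G) cs \<one>"
    using cs(3) g uv(2) by simp
  have "foldr (mult G) xs \<one> \<in> commutator_subgroup G" if "set xs \<subseteq> derived_set G (carrier G)" for xs
    using that unfolding derived_def by (induction xs) (auto intro: generate.intros)
  then show "g [^] k \<in> commutator_subgroup G"
    unfolding eq using cs(2) .
  have "comm_length G (g [^] k) \<le> length cs"
    unfolding comm_length_def by (rule Least_le) (use eq cs in auto)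
  then show "comm_length G (g [^] k) \<le> n"
    using cs uv by simp
qed

text \<open>
  The letters of a commutator \<open>[x, y]\<close> can be reordered as \<open>x x\<^sup>-\<^sup>1 y y\<^sup>-\<^sup>1\<close>,
  so a product of commutators and the identity are values of rearrangements of one word.
\<close>

lemma commutator_subgroup_word:
  assumes "g \<in> commutator_subgroup G"
  obtains u v where "word u = g" "word v = \<one>" "chain u = chain v"
proof -
  obtain cs where cs: "set cs \<subseteq> derived_set G (carrier G)" "g = foldr (mult G) cs \<one>"
    using ex_commutator_product[OF assms] by blast
  have "\<exists>u v. word u = foldr (mult G) cs \<one> \<and> word v = \<one> \<and> chain u = chain v"
    using cs(1)
  proof (induction cs)
    case Nil
    show ?case by (intro exI[of _ "[]"]) simp
  next
    case (Cons c cs)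
    then obtain u v where uv: "word u = foldr (mult G) cs \<one>" "word v = \<one>" "chain u = chain v"
      by auto
    obtain x y where xy: "x \<in> carrier G" "y \<in> carrier G" "c = x \<otimes> y \<otimes> inv x \<otimes> inv y"
      using Cons.prems by auto
    have "word ([x, y, inv x, inv y] @ u) = foldr (mult G) (c # cs) \<one>"
      using xy uv(1)[symmetric] by (simp add: letter_def m_assoc)
    moreover have "word ([x, inv x, y, inv y] @ v) = \<one>"
      using xy uv(2) by (simp add: letter_def m_assoc[symmetric])
    moreover have "chain ([x, y, inv x, inv y] @ u) = chain ([x, inv x, y, inv y] @ v)"
      using uv(3) by (simp add: ac_simps)
    ultimately show ?case by blast
  qed
  then show ?thesis using that cs(2) by blast
qed

lemma chain_representation:
  fixes a :: "'a \<Rightarrow>\<^sub>0 int"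
  obtains u v where "a = chain u - chain v"
proof -
  have "\<exists>u v. a = chain u - chain v"
  proof (rule frag_induction[of a UNIV])
    show "\<exists>u v. 0 = chain u - chain v"
      by (intro exI[of _ "[]"]) simp
  next
    fix x :: 'a
    show "\<exists>u v. frag_of x = chain u - chain v"
      by (intro exI[of _ "[x]"] exI[of _ "[]"]) simp
  next
    fix a b assume "\<exists>u v. a = chain u - chain v" "\<exists>u v. b = chain u - chain v"
    then obtain u v u' v' where "a = chain u - chain v" "b = chain u' - chain v'" by blast
    then show "\<exists>u v. a - b = chain u - chain v"
      by (intro exI[of _ "u @ v'"] exI[of _ "v @ u'"]) simp
  qed simp
  then show ?thesis using that by blast
qed

text \<open>
  The \<open>n\<close>-th powers of the two words that represent \<open>a\<close> have values in the commutator subgroup;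
  rearranged commutator words, which do not change the chain, make the two values equal.
\<close>

lemma ex_fillable:
  assumes n: "0 < n" "\<And>g. g \<in> carrier G \<Longrightarrow> g [^] (n::nat) \<in> commutator_subgroup G"
  shows "\<exists>m. fillable (nat_multiple n a) m"
proof -
  obtain u v where a: "a = chain u - chain v"
    by (rule chain_representation)
  obtain u1 u2 where u: "word u1 = word u [^] n" "word u2 = \<one>" "chain u1 = chain u2"
    using commutator_subgroup_word[OF n(2)[OF word_closed]] .
  obtain v1 v2 where v: "word v1 = word v [^] n" "word v2 = \<one>" "chain v1 = chain v2"
    using commutator_subgroup_word[OF n(2)[OF word_closed]] .
  let ?u = "concat (replicate n u) @ u2 @ v1" and ?v = "u1 @ concat (replicate n v) @ v2"
  have "nat_multiple n a = chain ?u - chain ?v"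
    using u v by (simp add: a chain_replicate sum_subtractf)
  moreover have "word ?u = word ?v"
    using u v by (simp add: word_replicate)
  ultimately show ?thesis
    unfolding fillable_def by blast
qed

text \<open>
  The stable filling norm. Passing to multiples makes it homogeneous, and finite on every
  chain when every element of the group has a positive power in the commutator subgroup.
\<close>

definition filling_norm :: "('a \<Rightarrow>\<^sub>0 int) \<Rightarrow> real" where
  "filling_norm a = Inf {real n / real m | m n. 0 < m \<and> fillable (nat_multiple m a) n}"

lemma filling_norm_le:
  assumes "0 < m" "fillable (nat_multiple m a) n"
  shows "filling_norm a \<le> real n / real m"
  unfolding filling_norm_def
  by (rule cInf_lower) (use assms in \<open>auto intro!: bdd_belowI[of _ 0]\<close>)

lemma filling_norm_greatest:
  assumes "\<exists>m n. 0 < m \<and> fillable (nat_multiple m a) n"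
    and "\<And>m n. 0 < m \<Longrightarrow> fillable (nat_multiple m a) n \<Longrightarrow> c \<le> real n / real m"
  shows "c \<le> filling_norm a"
  unfolding filling_norm_def by (rule cInf_greatest) (use assms in auto)

lemma sublinear_filling_norm:
  assumes ex: "\<And>a. \<exists>m n. 0 < m \<and> fillable (nat_multiple m a) n"
  shows "sublinear filling_norm"
  unfolding sublinear_def
proof (intro conjI allI)
  fix a b
  have *: "filling_norm (a + b) \<le> real n / real m + real n' / real m'"
    if "0 < m" "fillable (nat_multiple m a) n" "0 < m'" "fillable (nat_multiple m' b) n'" for m n m' n'
  proof -
    have "fillable (nat_multiple (m' * m) a + nat_multiple (m * m') b) (m' * n + m * n')"
      using that unfolding nat_multiple_mult by (intro fillable_add fillable_nat_multiple)
    then have "fillable (nat_multiple (m * m') (a + b)) (m' * n + m * n')"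
      by (simp only: sum.distrib mult.commute)
    from filling_norm_le[OF _ this] that show ?thesis
      by (simp add: field_simps)
  qed
  have "filling_norm (a + b) - real n / real m \<le> filling_norm b"
    if "0 < m" "fillable (nat_multiple m a) n" for m n
    using *[OF that] by (intro filling_norm_greatest ex) (auto simp: algebra_simps)
  then have "filling_norm (a + b) - filling_norm b \<le> filling_norm a"
    by (intro filling_norm_greatest ex) (auto simp: algebra_simps)
  then show "filling_norm (a + b) \<le> filling_norm a + filling_norm b" by simp
next
  fix k :: nat and a
  show "filling_norm (nat_multiple k a) = real k * filling_norm a"
  proof (cases "k = 0")
    case True
    have "fillable (nat_multiple 1 0) 0"
      unfolding fillable_def by (intro exI[of _ "[]"]) simp
    from filling_norm_le[OF _ this] have "filling_norm 0 \<le> 0" by simp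
    moreover have "0 \<le> filling_norm 0"
      by (intro filling_norm_greatest ex) auto
    ultimately show ?thesis using True by simp
  next
    case False
    have "filling_norm (nat_multiple k a) / real k \<le> real n / real m"
      if "0 < m" "fillable (nat_multiple m a) n" for m n
    proof -
      have "fillable (nat_multiple m (nat_multiple k a)) (k * n)"
        using fillable_nat_multiple[OF that(2), of k] by (metis mult.commute nat_multiple_mult)
      from filling_norm_le[OF that(1) this] show ?thesis
        using False by (simp add: field_simps)
    qed
    then have "filling_norm (nat_multiple k a) / real k \<le> filling_norm a"
      by (intro filling_norm_greatest ex)
    moreover have "real k * filling_norm a \<le> real n / real m"
      if "0 < m" "fillable (nat_multiple m (nat_multiple k a)) n" for m n
    proof -
      have "fillable (nat_multiple (m * k) a) n"
        using that(2) by (simp only: nat_multiple_mult)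
      from filling_norm_le[OF _ this] show ?thesis
        using False that(1) by (simp add: field_simps)
    qed
    then have "real k * filling_norm a \<le> filling_norm (nat_multiple k a)"
      by (intro filling_norm_greatest ex)
    ultimately show ?thesis
      using False by (simp add: field_simps)
  qed
qed

lemma scl_le_filling_norm:
  assumes g: "g \<in> carrier G" and ex: "\<exists>m n. 0 < m \<and> fillable (nat_multiple m (frag_of g)) n"
  shows "scl G g \<le> filling_norm (frag_of g)"
proof (rule filling_norm_greatest[OF ex])
  fix m n assume mn: "0 < m" "fillable (nat_multiple m (frag_of g)) n"
  have "scl G g \<le> real (comm_length G (g [^] m)) / real m"
    using fillable_comm_length(1)[OF g mn(2)] mn(1) by (intro scl_le_comm_length g)
  also have "\<dots> \<le> real n / real m"
    using fillable_comm_length(2)[OF g mn(2)] by (intro divide_right_mono) auto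
  finally show "scl G g \<le> real n / real m" .
qed

text \<open>
  The hard half of Bavard duality. A linear functional below the filling norm restricts
  to a quasimorphism on the group, because \<open>x + y - xy\<close> is filled by a relation of length 3;
  homogenizing multiplies its defect by at most 4.
\<close>

theorem scl_le_homogeneous_quasimorphism:
  assumes n: "0 < n" "\<And>g. g \<in> carrier G \<Longrightarrow> g [^] (n::nat) \<in> commutator_subgroup G"
    and g: "g \<in> carrier G"
  obtains \<phi> where "\<phi> \<in> homogeneous_quasimorphisms G" "defect_le G \<phi> 12" "scl G g \<le> \<phi> g + 3"
proof -
  have ex: "\<exists>m k. 0 < m \<and> fillable (nat_multiple m a) k" for a
    using n(1) ex_fillable[OF n] by blast
  obtain l where add: "\<And>a b. l (a + b) = l a + l b" and le: "\<And>a. l a \<le> filling_norm a"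
    and eq: "l (frag_of g) = filling_norm (frag_of g)"
    by (rule Hahn_Banach_abelian_group[OF sublinear_filling_norm[OF ex], of "frag_of g"]) (rule that)
  have minus: "l (a - b) = l a - l b" for a b
    using add[of "a - b" b] by simp
  have "defect_le G (\<lambda>x. l (frag_of x)) 3"
    unfolding defect_le_def
  proof (intro ballI)
    fix x y assume xy: "x \<in> carrier G" "y \<in> carrier G"
    let ?u = "[x \<otimes> y]" and ?v = "[x, y]"
    have eq: "word ?u = word ?v"
      using xy by (simp add: letter_def)
    have bound: "l (chain u - chain v) \<le> 3" if "word u = word v" "length u + length v = 3" for u v
    proof -
      have "fillable (chain u - chain v) 3"
        unfolding fillable_def using that by (intro exI[of _ u] exI[of _ v]) simp
      then have "filling_norm (chain u - chain v) \<le> 3"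
        using filling_norm_le[of 1 "chain u - chain v" 3] by simp
      then show ?thesis
        using le order_trans by blast
    qed
    have "l (chain ?u - chain ?v) \<le> 3" "l (chain ?v - chain ?u) \<le> 3"
      using eq by (intro bound; simp)+
    then show "\<bar>l (frag_of (x \<otimes> y)) - l (frag_of x) - l (frag_of y)\<bar> \<le> 3"
      by (simp add: add minus abs_le_iff)
  qed
  from homogenization[OF this] obtain \<phi> where \<phi>: "\<phi> \<in> homogeneous_quasimorphisms G"
    "defect_le G \<phi> (4 * 3)" "\<And>x. x \<in> carrier G \<Longrightarrow> \<bar>\<phi> x - l (frag_of x)\<bar> \<le> 3"
    by metis
  have "scl G g \<le> \<phi> g + 3"
    using scl_le_filling_norm[OF g ex] \<phi>(3)[OF g] eq by linarith
  then show ?thesis using that \<phi> by simp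
qed

end

section \<open>Finite-dimensional spaces of functions\<close>

text \<open>
  Induction on the spanning set: when a function \<open>b\<close> is added, the old points suffice unless the
  residual \<open>r\<close> of \<open>b\<close> is nonzero at some \<open>y\<close>, and then the residual of any function at \<open>y\<close>
  yields its coefficient at \<open>r\<close>. The new point \<open>y\<close> may already belong to \<open>F\<close>, in
  which case its two contributions to the interpolating family are added.
\<close>

lemma finite_dimensional_interpolation:
  fixes B :: "('a \<Rightarrow> real) set"
  assumes "finite B"
  shows "\<exists>F \<psi>. finite F \<and> (\<forall>x\<in>F. \<psi> x \<in> real_fun.span B) \<and>
           (\<forall>f\<in>real_fun.span B. \<forall>g. f g = (\<Sum>x\<in>F. f x * \<psi> x g))"
  using assms
proof (induction B)
  case empty
  show ?case by (intro exI[of _ "{}"]) (simp add: real_fun.span_empty)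
next
  case (insert b B)
  from insert.IH obtain F \<psi> where IH: "finite F \<and> (\<forall>x\<in>F. \<psi> x \<in> real_fun.span B) \<and>
      (\<forall>f\<in>real_fun.span B. \<forall>g. f g = (\<Sum>x\<in>F. f x * \<psi> x g))"
    by (elim exE)
  then have F: "finite F" "\<And>x. x \<in> F \<Longrightarrow> \<psi> x \<in> real_fun.span B"
    "\<And>f g. f \<in> real_fun.span B \<Longrightarrow> f g = (\<Sum>x\<in>F. f x * \<psi> x g)"
    by blast+
  have mono: "f \<in> real_fun.span (insert b B)" if "f \<in> real_fun.span B" for f
    using that real_fun.span_mono[of B "insert b B"] by blast
  define r where "r g = b g - (\<Sum>x\<in>F. b x * \<psi> x g)" for g
  have residual: "\<exists>t. \<forall>g. f g = (\<Sum>x\<in>F. f x * \<psi> x g) + t * r g" if f: "f \<in> real_fun.span (insert b B)" for f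
  proof -
    obtain t where "f - (\<lambda>x. t * b x) \<in> real_fun.span B"
      using f by (auto simp: real_fun.span_insert)
    from F(3)[OF this] have "f g - t * b g = (\<Sum>x\<in>F. (f x - t * b x) * \<psi> x g)" for g
      unfolding fun_diff_def .
    moreover have "(\<Sum>x\<in>F. (f x - t * b x) * \<psi> x g) = (\<Sum>x\<in>F. f x * \<psi> x g) - t * (\<Sum>x\<in>F. b x * \<psi> x g)" for g
      unfolding left_diff_distrib sum_subtractf sum_distrib_left mult.assoc ..
    ultimately have "f g - t * b g = (\<Sum>x\<in>F. f x * \<psi> x g) - t * (\<Sum>x\<in>F. b x * \<psi> x g)" for g
      by simp
    then have "f g = (\<Sum>x\<in>F. f x * \<psi> x g) + t * r g" for g
      unfolding r_def right_diff_distrib by (metis add_diff_eq diff_add_cancel add.commute)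
    then show ?thesis by blast
  qed
  show ?case
  proof (cases "\<forall>g. r g = 0")
    case True
    then show ?thesis
      using F mono residual by (intro exI[of _ F] exI[of _ \<psi>]) fastforce
  next
    case False
    then obtain y where y: "r y \<noteq> 0" by blast
    have "(\<Sum>x\<in>F. (\<lambda>g. b x * \<psi> x g)) \<in> real_fun.span (insert b B)"
      using F(2) mono by (intro real_fun.span_sum real_fun.span_scale[of "\<psi> _"]) auto
    from real_fun.span_diff[OF real_fun.span_base[OF insertI1] this]
    have "b - (\<Sum>x\<in>F. (\<lambda>g. b x * \<psi> x g)) \<in> real_fun.span (insert b B)" .
    moreover have "b - (\<Sum>x\<in>F. (\<lambda>g. b x * \<psi> x g)) = r"
    proof -
      have "(\<Sum>x\<in>F. (\<lambda>g. b x * \<psi> x g)) g = (\<Sum>x\<in>F. b x * \<psi> x g)" for g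
        using F(1) by (induction F) auto
      then show ?thesis by (auto simp: r_def fun_eq_iff)
    qed
    ultimately have r: "r \<in> real_fun.span (insert b B)" by simp
    have r': "(\<lambda>g. c * r g) \<in> real_fun.span (insert b B)" for c
      by (rule real_fun.span_scale[OF r])
    define \<psi>1 where "\<psi>1 x = (if x \<in> F then \<psi> x else 0)" for x
    define \<psi>' where "\<psi>' x = \<psi>1 x + (\<lambda>g. ((if x = y then 1 else 0) - \<psi>1 x y) / r y * r g)" for x
    have "\<psi>1 x \<in> real_fun.span (insert b B)" for x
      using F(2) mono real_fun.span_zero by (auto simp: \<psi>1_def)
    then have span: "\<psi>' x \<in> real_fun.span (insert b B)" for x
      unfolding \<psi>'_def by (intro real_fun.span_add r')
    have "f g = (\<Sum>x\<in>insert y F. f x * \<psi>' x g)" if f: "f \<in> real_fun.span (insert b B)" for f g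
    proof -
      obtain t where t: "\<And>g. f g = (\<Sum>x\<in>F. f x * \<psi> x g) + t * r g"
        using residual[OF f] by blast
      have \<psi>1: "(\<Sum>x\<in>insert y F. f x * \<psi>1 x h) = (\<Sum>x\<in>F. f x * \<psi> x h)" for h
        using F(1) by (intro sum.mono_neutral_cong_right) (auto simp: \<psi>1_def)
      have delta: "(\<Sum>x\<in>insert y F. f x * (if x = y then 1 else 0)) = f y"
        using F(1) by (simp add: if_distrib cong: if_cong)
      have "(\<Sum>x\<in>insert y F. f x * \<psi>' x g) =
          (\<Sum>x\<in>insert y F. f x * \<psi>1 x g) +
          ((\<Sum>x\<in>insert y F. f x * (if x = y then 1 else 0)) - (\<Sum>x\<in>insert y F. f x * \<psi>1 x y)) * (r g / r y)"
        unfolding \<psi>'_def plus_fun_apply sum_subtractf[symmetric] sum_distrib_right sum.distrib[symmetric]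
        by (rule sum.cong) (auto simp: algebra_simps diff_divide_distrib)
      also have "\<dots> = (\<Sum>x\<in>F. f x * \<psi> x g) + (f y - (\<Sum>x\<in>F. f x * \<psi> x y)) * (r g / r y)"
        by (simp only: \<psi>1 delta)
      also have "\<dots> = f g"
        using y unfolding t[of g] t[of y] by simp
      finally show ?thesis by simp
    qed
    then show ?thesis
      using F(1) span by (intro exI[of _ "insert y F"] exI[of _ \<psi>']) simp
  qed
qed

text \<open>
  By Bavard duality \<open>scl g\<close> is, up to an additive constant, at most the value at \<open>g\<close> of some
  homogeneous quasimorphism \<open>\<phi>\<close> of defect at most 12. The easy half of the duality bounds
  its coefficients \<open>\<phi> x\<close> in the interpolating family, uniformly in \<open>g\<close>.
\<close>

theorem (in group) scl_le_sum_quasimorphisms: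
  assumes n: "0 < n" "\<And>g. g \<in> carrier G \<Longrightarrow> g [^] (n::nat) \<in> commutator_subgroup G"
    and fin: "finite_dimensional (homogeneous_quasimorphisms G)"
  obtains F :: "'a set" and \<psi> C where "finite F" "\<And>x. x \<in> F \<Longrightarrow> \<psi> x \<in> homogeneous_quasimorphisms G" "0 \<le> C"
    "\<And>g. g \<in> carrier G \<Longrightarrow> scl G g \<le> 3 + C * (\<Sum>x\<in>F. \<bar>\<psi> x g\<bar>)"
proof -
  obtain B where "finite B" "real_fun.span B = homogeneous_quasimorphisms G"
    using fin by (auto simp: finite_dimensional_def)
  with finite_dimensional_interpolation[of B] obtain F \<psi> where
    "finite F \<and> (\<forall>x\<in>F. \<psi> x \<in> homogeneous_quasimorphisms G) \<and>
     (\<forall>f\<in>homogeneous_quasimorphisms G. \<forall>g. f g = (\<Sum>x\<in>F. f x * \<psi> x g))"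
    by auto
  then have F: "finite F" "\<And>x. x \<in> F \<Longrightarrow> \<psi> x \<in> homogeneous_quasimorphisms G"
    "\<And>f g. f \<in> homogeneous_quasimorphisms G \<Longrightarrow> f g = (\<Sum>x\<in>F. f x * \<psi> x g)"
    by blast+
  define c where "c x = \<bar>4 * 12 * scl G x\<bar>" for x
  define C where "C = (\<Sum>x\<in>F. c x)"
  have C: "c x \<le> C" if "x \<in> F" for x
    unfolding C_def using F(1) that by (intro member_le_sum) (auto simp: c_def)
  have bound: "scl G g \<le> 3 + C * (\<Sum>x\<in>F. \<bar>\<psi> x g\<bar>)" if g: "g \<in> carrier G" for g
  proof -
    obtain \<phi> where \<phi>: "\<phi> \<in> homogeneous_quasimorphisms G" "defect_le G \<phi> 12" "scl G g \<le> \<phi> g + 3"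
      by (rule scl_le_homogeneous_quasimorphism[OF n g])
    have coeff: "\<bar>\<phi> x\<bar> \<le> C" if "x \<in> F" for x
    proof (cases "x \<in> carrier G")
      case True
      then have "\<bar>\<phi> x\<bar> \<le> 4 * 12 * scl G x"
        using n by (intro homogeneous_quasimorphism_le_scl[OF \<phi>(1,2)]) auto
      then show ?thesis using C[OF that] by (simp add: c_def)
    next
      case False
      then have "\<phi> x = 0"
        using \<phi>(1) by (auto simp: homogeneous_quasimorphisms_def)
      then show ?thesis using C[OF that] by (simp add: c_def)
    qed
    have "\<phi> g = (\<Sum>x\<in>F. \<phi> x * \<psi> x g)"
      by (rule F(3)[OF \<phi>(1)])
    also have "\<dots> \<le> (\<Sum>x\<in>F. C * \<bar>\<psi> x g\<bar>)"
    proof (rule sum_mono)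
      fix x assume x: "x \<in> F"
      have "\<phi> x * \<psi> x g \<le> \<bar>\<phi> x\<bar> * \<bar>\<psi> x g\<bar>"
        by (metis abs_ge_self abs_mult)
      also have "\<dots> \<le> C * \<bar>\<psi> x g\<bar>"
        by (rule mult_right_mono[OF coeff[OF x]]) simp
      finally show "\<phi> x * \<psi> x g \<le> C * \<bar>\<psi> x g\<bar>" .
    qed
    finally show ?thesis
      using \<phi>(3) by (simp add: sum_distrib_left)
  qed
  have "0 \<le> C"
    unfolding C_def by (intro sum_nonneg) (auto simp: c_def)
  from that[OF F(1,2) this bound] show ?thesis .
qed

lemma (in group) finite_abelianization_pow:
  assumes "finite (carrier (G Mod commutator_subgroup G))"
  obtains n :: nat where "0 < n" "\<And>g. g \<in> carrier G \<Longrightarrow> g [^] n \<in> commutator_subgroup G"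
proof -
  let ?H = "commutator_subgroup G"
  interpret H: normal ?H G
    by (rule derived_self_is_normal)
  interpret Q: group "G Mod ?H"
    by (rule H.factorgroup_is_group)
  have hom: "group_hom G (G Mod ?H) (\<lambda>g. ?H #> g)"
    by (intro group_hom.intro group_axioms Q.group_axioms group_hom_axioms.intro H.r_coset_hom_Mod)
  have "g [^] order (G Mod ?H) \<in> ?H" if g: "g \<in> carrier G" for g
  proof -
    have "?H #> (g [^] order (G Mod ?H)) = (?H #> g) [^]\<^bsub>G Mod ?H\<^esub> order (G Mod ?H)"
      using g by (rule group_hom.hom_nat_pow[OF hom])
    also have "\<dots> = ?H"
      using g Q.pow_order_eq_1[of "?H #> g"] group_hom.hom_closed[OF hom g] by simp
    finally show ?thesis
      using g H.subgroup_axioms by (metis coset_join1 nat_pow_closed H.subset)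
  qed
  moreover have "0 < order (G Mod ?H)"
    using assms Q.order_gt_0_iff_finite by blast
  ultimately show ?thesis using that by blast
qed

section \<open>Averages over the random walk\<close>

text \<open>
  Expectations along the walk are written as finite averages, so that independence and measurability
  are used only once, when these averages are identified with integrals.
\<close>

primrec walk_mean :: "('a, 'b) monoid_scheme \<Rightarrow> 'a set \<Rightarrow> nat \<Rightarrow> ('a \<Rightarrow> real) \<Rightarrow> real" where
  "walk_mean G S 0 f = f \<one>\<^bsub>G\<^esub>"
| "walk_mean G S (Suc n) f = walk_mean G S n (\<lambda>g. (\<Sum>x\<in>S. f (g \<otimes>\<^bsub>G\<^esub> x)) / real (card S))"

locale symmetric_walk = group G for G (structure) +
  fixes S
  assumes finite_S: "finite S" and S_nonempty: "S \<noteq> {}" and S_closed: "S \<subseteq> carrier G"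
    and S_inv: "\<And>x. x \<in> S \<Longrightarrow> inv x \<in> S"
begin

abbreviation E :: "nat \<Rightarrow> ('a \<Rightarrow> real) \<Rightarrow> real" where
  "E \<equiv> walk_mean G S"

lemma card_S_pos: "0 < real (card S)"
  using finite_S S_nonempty by (simp add: card_gt_0_iff)

lemma S_carrier [simp]: "x \<in> S \<Longrightarrow> x \<in> carrier G"
  using S_closed by blast

lemma mean_mono:
  assumes "\<And>g. g \<in> carrier G \<Longrightarrow> f g \<le> h g"
  shows "E n f \<le> E n h"
  using assms
proof (induction n arbitrary: f h)
  case (Suc n)
  show ?case
    unfolding walk_mean.simps
    by (rule Suc.IH) (intro divide_right_mono sum_mono Suc.prems, auto)
qed simp

lemma mean_cong:
  assumes "\<And>g. g \<in> carrier G \<Longrightarrow> f g = h g"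
  shows "E n f = E n h"
  by (intro antisym mean_mono) (use assms in auto)

lemma mean_add: "E n (\<lambda>g. f g + h g) = E n f + E n h"
  by (induction n arbitrary: f h) (simp_all add: sum.distrib add_divide_distrib)

lemma mean_scale: "E n (\<lambda>g. c * f g) = c * E n f"
  by (induction n arbitrary: f) (simp_all flip: sum_distrib_left times_divide_eq_right)

lemma mean_minus: "E n (\<lambda>g. - f g) = - E n f"
  using mean_scale[of n "-1" f] by simp

lemma mean_diff: "E n (\<lambda>g. f g - h g) = E n f - E n h"
  using mean_add[of n f "\<lambda>g. - h g"] by (simp add: mean_minus)

lemma mean_const: "E n (\<lambda>g. c) = c"
  using card_S_pos by (induction n) simp_all

lemma mean_sum:
  assumes "finite I"
  shows "E n (\<lambda>g. \<Sum>i\<in>I. f i g) = (\<Sum>i\<in>I. E n (f i))"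
  using assms by (induction I) (simp_all add: mean_const mean_add)

lemma mean_abs: "\<bar>E n f\<bar> \<le> E n (\<lambda>g. \<bar>f g\<bar>)"
  using mean_mono[of f "\<lambda>g. \<bar>f g\<bar>" n] mean_mono[of "\<lambda>g. - f g" "\<lambda>g. \<bar>f g\<bar>" n]
  by (simp add: mean_minus abs_le_iff)

lemma mean_nonneg:
  assumes "\<And>g. g \<in> carrier G \<Longrightarrow> 0 \<le> f g"
  shows "0 \<le> E n f"
  using mean_mono[of "\<lambda>_. 0" f n] assms by (simp add: mean_const)

lemma mean_le_const:
  assumes "\<And>g. g \<in> carrier G \<Longrightarrow> f g \<le> c"
  shows "E n f \<le> c"
  using mean_mono[of f "\<lambda>_. c" n] assms by (simp add: mean_const)

lemma mean_square: "(E n f)\<^sup>2 \<le> E n (\<lambda>g. (f g)\<^sup>2)"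
proof -
  let ?a = "E n f"
  have "0 \<le> E n (\<lambda>g. (f g - ?a)\<^sup>2)"
    by (rule mean_nonneg) simp
  also have "\<dots> = E n (\<lambda>g. ((f g)\<^sup>2 - (2 * ?a) * f g) + ?a\<^sup>2)"
    by (rule mean_cong) (simp add: power2_diff algebra_simps)
  also have "\<dots> = E n (\<lambda>g. (f g)\<^sup>2) - ?a\<^sup>2"
    by (simp only: mean_add mean_diff mean_scale mean_const) (simp add: power2_eq_square)
  finally show ?thesis by simp
qed

lemma mean_split: "E (m + n) f = E m (\<lambda>g. E n (\<lambda>h. f (g \<otimes> h)))"
proof (induction n arbitrary: f)
  case 0
  show ?case by (auto intro: mean_cong)
next
  case (Suc n)
  show ?case
    unfolding add_Suc_right walk_mean.simps Suc.IH
    by (intro mean_cong) (auto simp: m_assoc intro!: sum.cong)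
qed

lemma mean_one: "E 1 f = (\<Sum>x\<in>S. f x) / real (card S)"
  by (auto intro!: sum.cong)

text \<open>
  Inversion turns the last step into a first step, so the proof reads the walk from both ends;
  symmetry of \<open>S\<close> lets the inverse of a step be replaced by a step.
\<close>

lemma mean_inv: "E n (\<lambda>g. f (inv g)) = E n f"
proof (induction n arbitrary: f)
  case (Suc n)
  have inv_bij: "bij_betw (\<lambda>x. inv x) S S"
    by (rule bij_betwI[where g = "\<lambda>x. inv x"]) (auto simp: S_inv)
  have "E (Suc n) (\<lambda>g. f (inv g)) = E n (\<lambda>g. E 1 (\<lambda>x. f (inv (g \<otimes> x))))"
    using mean_split[of n 1] by simp
  also have "\<dots> = E n (\<lambda>g. E 1 (\<lambda>x. f (x \<otimes> inv g)))"
  proof (rule mean_cong)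
    fix g assume g: "g \<in> carrier G"
    have "(\<Sum>x\<in>S. f (inv (g \<otimes> x))) = (\<Sum>x\<in>S. f (inv x \<otimes> inv g))"
      using g by (intro sum.cong) (auto simp: inv_mult_group)
    also have "\<dots> = (\<Sum>x\<in>S. f (x \<otimes> inv g))"
      by (rule sum.reindex_bij_betw[OF inv_bij])
    finally show "E 1 (\<lambda>x. f (inv (g \<otimes> x))) = E 1 (\<lambda>x. f (x \<otimes> inv g))"
      unfolding mean_one by simp
  qed
  also have "\<dots> = E n (\<lambda>g. E 1 (\<lambda>x. f (x \<otimes> g)))"
    by (rule Suc.IH[of "\<lambda>g. E 1 (\<lambda>x. f (x \<otimes> g))"])
  also have "\<dots> = E 1 (\<lambda>x. E n (\<lambda>g. f (x \<otimes> g)))"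
    unfolding mean_one using finite_S
    by (simp add: mean_sum mean_scale[of n "1 / real (card S)", simplified])
  also have "\<dots> = E (Suc n) f"
    using mean_split[of 1 n f] by simp
  finally show ?case .
qed simp

lemma mean_odd:
  assumes "\<And>g. g \<in> carrier G \<Longrightarrow> f (inv g) = - f g"
  shows "E n f = 0"
proof -
  have "E n f = E n (\<lambda>g. f (inv g))" by (rule mean_inv[symmetric])
  also have "\<dots> = E n (\<lambda>g. - f g)" by (intro mean_cong assms)
  finally show ?thesis by (simp add: mean_minus)
qed

lemma walk_cong:
  assumes "\<And>i. i < n \<Longrightarrow> s i \<omega> = s' i \<omega>'"
  shows "walk G s n \<omega> = walk G s' n \<omega>'"
  using assms by (induction n) auto

lemma walk_Suc_as_sum:
  fixes h :: "'a \<Rightarrow> real"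
  assumes "s n \<omega> \<in> S"
  shows "h (walk G s (Suc n) \<omega>) = (\<Sum>x\<in>S. h (walk G s n \<omega> \<otimes> x) * indicator {x} (s n \<omega>))"
proof -
  have "(\<Sum>x\<in>S. h (walk G s n \<omega> \<otimes> x) * indicator {x} (s n \<omega>)) =
      (\<Sum>x\<in>S. if x = s n \<omega> then h (walk G s n \<omega> \<otimes> x) else 0)"
    by (intro sum.cong) (auto simp: indicator_def)
  then show ?thesis using assms finite_S by simp
qed

lemma walk_measurable:
  fixes h :: "'a \<Rightarrow> real"
  assumes "\<And>i. i < n \<Longrightarrow> s i \<in> measurable N (count_space S)"
  shows "(\<lambda>\<omega>. h (walk G s n \<omega>)) \<in> borel_measurable N"
  using assms
proof (induction n arbitrary: h)
  case (Suc n)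
  have s: "s n \<in> measurable N (count_space S)" using Suc.prems by simp
  have "(\<lambda>\<omega>. \<Sum>x\<in>S. h (walk G s n \<omega> \<otimes> x) * indicator {x} (s n \<omega>)) \<in> borel_measurable N"
  proof (intro borel_measurable_sum borel_measurable_times)
    fix x
    show "(\<lambda>\<omega>. h (walk G s n \<omega> \<otimes> x)) \<in> borel_measurable N"
      using Suc.prems by (intro Suc.IH[of "\<lambda>g. h (g \<otimes> x)"]) auto
    show "(\<lambda>\<omega>. indicator {x} (s n \<omega>) :: real) \<in> borel_measurable N"
      by (rule measurable_compose[OF s]) simp
  qed
  also have "?this \<longleftrightarrow> (\<lambda>\<omega>. h (walk G s (Suc n) \<omega>)) \<in> borel_measurable N"
    using measurable_space[OF s] by (intro measurable_cong walk_Suc_as_sum[symmetric]) simp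
  finally show ?case .
qed simp

text \<open>
  The position before the last step is a function of the earlier steps, so it is independent of the
  last step; splitting over the values of the last step gives the recursion of the averages.
\<close>

lemma expectation_walk:
  fixes f :: "'a \<Rightarrow> real"
  assumes M: "prob_space M"
    and indep: "prob_space.indep_vars M (\<lambda>_. count_space S) s UNIV"
    and unif: "\<And>i. distr M (count_space S) (s i) = uniform_count_measure S"
  shows "integrable M (\<lambda>\<omega>. f (walk G s n \<omega>)) \<and> (\<integral>\<omega>. f (walk G s n \<omega>) \<partial>M) = E n f"
proof (induction n arbitrary: f)
  interpret prob_space M by (rule M)
  case 0
  show ?case by (simp add: prob_space)
next
  interpret prob_space M by (rule M)
  case (Suc n)
  have s: "s i \<in> measurable M (count_space S)" for i
    using indep by (auto simp: indep_vars_def)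
  let ?Y = "\<lambda>x \<omega>. indicator {x} (s n \<omega>) :: real"
  let ?X = "\<lambda>x \<omega>. f (walk G s n \<omega> \<otimes> x)"
  have Y: "integrable M (?Y x)" "expectation (?Y x) = 1 / card S" if x: "x \<in> S" for x
  proof -
    have "integrable (distr M (count_space S) (s n)) (indicator {x} :: 'a \<Rightarrow> real)"
      unfolding unif using x finite_S by (simp add: integrable_indicator_iff emeasure_uniform_count_measure)
    then show "integrable M (?Y x)"
      by (rule integrable_distr[OF s])
    have "expectation (?Y x) = integral\<^sup>L (distr M (count_space S) (s n)) (indicator {x})"
      by (rule integral_distr[symmetric, OF s]) simp
    also have "\<dots> = measure (uniform_count_measure S) {x}"
      unfolding unif using x by simp
    also have "\<dots> = 1 / card S"
      using x finite_S by (simp add: measure_uniform_count_measure)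
    finally show "expectation (?Y x) = 1 / card S" .
  qed
  have X: "integrable M (?X x)" "expectation (?X x) = E n (\<lambda>g. f (g \<otimes> x))" for x
    using Suc.IH[of "\<lambda>g. f (g \<otimes> x)"] by auto
  have XY: "indep_var borel (?X x) borel (?Y x)" for x
  proof -
    let ?N = "\<lambda>I. Pi\<^sub>M I (\<lambda>_. count_space S)"
    let ?F = "\<lambda>v. f (walk G (\<lambda>i v. v i) n v \<otimes> x)" and ?H = "\<lambda>v. indicator {x} (v n) :: real"
    have "indep_var (?N {..<n}) (\<lambda>\<omega>. restrict (\<lambda>i. s i \<omega>) {..<n}) (?N {n}) (\<lambda>\<omega>. restrict (\<lambda>i. s i \<omega>) {n})"
      by (rule indep_var_restrict[OF indep]) auto
    moreover have "?F \<in> borel_measurable (?N {..<n})"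
      by (rule walk_measurable[where h = "\<lambda>g. f (g \<otimes> x)"]) simp
    moreover have "?H \<in> borel_measurable (?N {n})"
      by (rule measurable_compose[of "\<lambda>v. v n" _ "count_space S"]) simp_all
    ultimately have "indep_var borel (?F \<circ> (\<lambda>\<omega>. restrict (\<lambda>i. s i \<omega>) {..<n}))
        borel (?H \<circ> (\<lambda>\<omega>. restrict (\<lambda>i. s i \<omega>) {n}))"
      by (rule indep_var_compose)
    moreover have "walk G (\<lambda>i v. v i) n (restrict (\<lambda>i. s i \<omega>) {..<n}) = walk G s n \<omega>" for \<omega>
      by (rule walk_cong) simp
    ultimately show ?thesis by (simp add: comp_def)
  qed
  have term_int: "integrable M (\<lambda>\<omega>. ?X x \<omega> * ?Y x \<omega>)"
    and term_exp: "expectation (\<lambda>\<omega>. ?X x \<omega> * ?Y x \<omega>) = E n (\<lambda>g. f (g \<otimes> x)) / card S" if "x \<in> S" for x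
    using indep_var_integrable[OF XY X(1) Y(1)[OF that]]
      indep_var_lebesgue_integral[OF XY X(1) Y(1)[OF that]] X(2) Y(2)[OF that] by simp_all
  have eq: "f (walk G s (Suc n) \<omega>) = (\<Sum>x\<in>S. ?X x \<omega> * ?Y x \<omega>)" if "\<omega> \<in> space M" for \<omega>
    using measurable_space[OF s that] by (intro walk_Suc_as_sum) simp
  have "integrable M (\<lambda>\<omega>. \<Sum>x\<in>S. ?X x \<omega> * ?Y x \<omega>)"
    by (intro Bochner_Integration.integrable_sum term_int)
  moreover have "expectation (\<lambda>\<omega>. \<Sum>x\<in>S. ?X x \<omega> * ?Y x \<omega>) = (\<Sum>x\<in>S. E n (\<lambda>g. f (g \<otimes> x)) / card S)"
    using term_int term_exp by (subst Bochner_Integration.integral_sum) auto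
  moreover have "(\<Sum>x\<in>S. E n (\<lambda>g. f (g \<otimes> x)) / card S) = E (Suc n) f"
    using finite_S mean_scale[of n "1 / real (card S)" "\<lambda>g. \<Sum>x\<in>S. f (g \<otimes> x)"]
    by (simp add: mean_sum sum_divide_distrib)
  ultimately show ?case
    using Bochner_Integration.integrable_cong[of M M, OF refl eq]
      Bochner_Integration.integral_cong[of M M, OF refl eq] by simp
qed

lemma prob_walk:
  assumes M: "prob_space M"
    and indep: "prob_space.indep_vars M (\<lambda>_. count_space S) s UNIV"
    and unif: "\<And>i. distr M (count_space S) (s i) = uniform_count_measure S"
  shows "measure M {\<omega> \<in> space M. P (walk G s n \<omega>)} = E n (\<lambda>g. of_bool (P g))"
proof -
  interpret prob_space M by (rule M)
  let ?A = "{\<omega> \<in> space M. P (walk G s n \<omega>)}"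
  have s: "s i \<in> measurable M (count_space S)" for i
    using indep by (auto simp: indep_vars_def)
  have "(\<lambda>\<omega>. of_bool (P (walk G s n \<omega>)) :: real) \<in> borel_measurable M"
    by (rule walk_measurable[OF s])
  then have "{\<omega> \<in> space M. of_bool (P (walk G s n \<omega>)) = (1::real)} \<in> sets M"
    by measurable
  then have A: "?A \<in> sets M" by simp
  have "measure M ?A = expectation (indicator ?A)"
    using A by simp
  also have "\<dots> = expectation (\<lambda>\<omega>. of_bool (P (walk G s n \<omega>)))"
    by (rule Bochner_Integration.integral_cong) (auto simp: indicator_def)
  also have "\<dots> = E n (\<lambda>g. of_bool (P g))"
    using expectation_walk[OF M indep unif, of "\<lambda>g. of_bool (P g)" n] by blast
  finally show ?thesis .
qed

end

section \<open>Harmonic representatives and moments\<close>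

context symmetric_walk
begin

definition step_mean :: "('a \<Rightarrow> real) \<Rightarrow> real" where
  "step_mean f = (\<Sum>x\<in>S. f x) / real (card S)"

lemma mean_Suc: "E (Suc n) f = E n (\<lambda>g. step_mean (\<lambda>x. f (g \<otimes> x)))"
  by (simp add: step_mean_def)

lemma mean_Suc': "E (Suc n) f = step_mean (\<lambda>x. E n (\<lambda>g. f (x \<otimes> g)))"
  using mean_split[of 1 n f] mean_one[of "\<lambda>x. E n (\<lambda>g. f (x \<otimes> g))"] by (simp add: step_mean_def)

lemma step_mean_mono:
  assumes "\<And>x. x \<in> S \<Longrightarrow> f x \<le> h x"
  shows "step_mean f \<le> step_mean h"
  unfolding step_mean_def by (intro divide_right_mono sum_mono assms) auto

lemma step_mean_cong:
  assumes "\<And>x. x \<in> S \<Longrightarrow> f x = h x"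
  shows "step_mean f = step_mean h"
  unfolding step_mean_def using assms by simp

lemma step_mean_add: "step_mean (\<lambda>x. f x + h x) = step_mean f + step_mean h"
  by (simp add: step_mean_def sum.distrib add_divide_distrib)

lemma step_mean_scale: "step_mean (\<lambda>x. c * f x) = c * step_mean f"
  by (simp add: step_mean_def flip: sum_distrib_left)

lemma step_mean_const: "step_mean (\<lambda>x. c) = c"
  using card_S_pos by (simp add: step_mean_def)

definition harmonic :: "('a \<Rightarrow> real) \<Rightarrow> bool" where
  "harmonic \<psi> \<longleftrightarrow> (\<forall>g\<in>carrier G. step_mean (\<lambda>x. \<psi> (g \<otimes> x)) = \<psi> g)"

lemma mean_harmonic:
  assumes "harmonic \<psi>" "g \<in> carrier G"
  shows "E n (\<lambda>h. \<psi> (g \<otimes> h)) = \<psi> g"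
proof (induction n)
  case 0
  then show ?case using assms by simp
next
  case (Suc n)
  have "E (Suc n) (\<lambda>h. \<psi> (g \<otimes> h)) = E n (\<lambda>h. \<psi> (g \<otimes> h))"
    unfolding mean_Suc
  proof (rule mean_cong)
    fix h assume h: "h \<in> carrier G"
    have "step_mean (\<lambda>x. \<psi> (g \<otimes> (h \<otimes> x))) = step_mean (\<lambda>x. \<psi> (g \<otimes> h \<otimes> x))"
      using assms(2) h by (intro step_mean_cong) (simp add: m_assoc)
    then show "step_mean (\<lambda>x. \<psi> (g \<otimes> (h \<otimes> x))) = \<psi> (g \<otimes> h)"
      using assms h by (simp add: harmonic_def)
  qed
  then show ?case using Suc by simp
qed

lemma mean_homogeneous:
  assumes "\<phi> \<in> homogeneous_quasimorphisms G"
  shows "E n \<phi> = 0"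
  by (rule mean_odd) (rule homogeneous_quasimorphism_pow(2)[OF assms])

lemma mean_translate:
  assumes \<phi>: "\<phi> \<in> homogeneous_quasimorphisms G" "defect_le G \<phi> D" and g: "g \<in> carrier G"
  shows "\<bar>E n (\<lambda>h. \<phi> (g \<otimes> h)) - \<phi> g\<bar> \<le> D"
proof -
  have "E n (\<lambda>h. \<phi> (g \<otimes> h)) - \<phi> g = E n (\<lambda>h. \<phi> (g \<otimes> h) - \<phi> g - \<phi> h)"
    using mean_homogeneous[OF \<phi>(1), of n] by (simp add: mean_diff mean_const)
  also have "\<bar>\<dots>\<bar> \<le> E n (\<lambda>h. \<bar>\<phi> (g \<otimes> h) - \<phi> g - \<phi> h\<bar>)"
    by (rule mean_abs)
  also have "\<dots> \<le> D"
    using g by (intro mean_le_const defect_leD[OF \<phi>(2)])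
  finally show ?thesis .
qed

text \<open>
  The Cesaro averages of the translated means \<open>g \<mapsto> E n (\<lambda>h. \<phi> (g h))\<close> stay within \<open>D\<close> of \<open>\<phi>\<close> because
  \<open>\<phi>\<close> has mean zero, and the \<open>N\<close>-th one is harmonic up to \<open>D / (N + 1)\<close> by telescoping.
  A limit point exists since the functions within \<open>D\<close> of \<open>\<phi>\<close> form a compact set
  for pointwise convergence.
\<close>

theorem harmonic_representative:
  assumes \<phi>: "\<phi> \<in> homogeneous_quasimorphisms G" "defect_le G \<phi> D"
  obtains \<psi> where "harmonic \<psi>" "\<And>g. g \<in> carrier G \<Longrightarrow> \<bar>\<psi> g - \<phi> g\<bar> \<le> D"
proof -
  have D: "0 \<le> D" by (rule defect_le_nonneg[OF \<phi>(2)])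
  define K where "K = PiE UNIV (\<lambda>g. {\<phi> g - D..\<phi> g + D})"
  define C where "C N = {\<psi>. \<forall>g\<in>carrier G. \<bar>step_mean (\<lambda>x. \<psi> (g \<otimes> x)) - \<psi> g\<bar> \<le> D / real (Suc N)}" for N :: nat
  define u where "u j g = (if g \<in> carrier G then E j (\<lambda>h. \<phi> (g \<otimes> h)) else \<phi> g)" for j g
  define a where "a N g = (\<Sum>j<Suc N. u j g) / real (Suc N)" for N g
  have "compactin (product_topology (\<lambda>_. euclidean) UNIV) K"
    unfolding K_def compactin_PiE by auto
  then have compact: "compact K"
    unfolding euclidean_product_topology by simp
  have closed: "closed (C N)" for N
  proof -
    have coord: "continuous_on UNIV (\<lambda>\<psi> :: 'a \<Rightarrow> real. \<psi> g)" for g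
      by (rule continuous_on_product_coordinates)
    have "C N = (\<Inter>g\<in>carrier G. {\<psi>. \<bar>step_mean (\<lambda>x. \<psi> (g \<otimes> x)) - \<psi> g\<bar> \<le> D / real (Suc N)})"
      by (auto simp: C_def)
    also have "closed \<dots>"
      unfolding step_mean_def using card_S_pos
      by (intro closed_INT ballI closed_Collect_le continuous_intros coord) auto
    finally show ?thesis .
  qed
  have u_close: "\<bar>u j g - \<phi> g\<bar> \<le> D" for j g
    using mean_translate[OF \<phi>] D by (simp add: u_def)
  have u_step: "step_mean (\<lambda>x. u j (g \<otimes> x)) = u (Suc j) g" if g: "g \<in> carrier G" for j g
  proof -
    have "u (Suc j) g = step_mean (\<lambda>x. E j (\<lambda>h. \<phi> (g \<otimes> (x \<otimes> h))))"
      using g by (simp add: u_def mean_Suc' del: walk_mean.simps)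
    also have "\<dots> = step_mean (\<lambda>x. u j (g \<otimes> x))"
      using g by (intro step_mean_cong) (auto simp: u_def m_assoc intro!: mean_cong)
    finally show ?thesis by simp
  qed
  have a_K: "a N \<in> K" for N
  proof -
    have "\<bar>a N g - \<phi> g\<bar> \<le> D" for g
    proof -
      have "a N g - \<phi> g = (\<Sum>j<Suc N. u j g - \<phi> g) / real (Suc N)"
        unfolding a_def sum_subtractf diff_divide_distrib by simp
      also have "\<bar>\<dots>\<bar> \<le> (\<Sum>j<Suc N. \<bar>u j g - \<phi> g\<bar>) / real (Suc N)"
        unfolding abs_divide by (simp only: abs_of_nat) (intro divide_right_mono sum_abs, simp)
      also have "\<dots> \<le> (\<Sum>j<Suc N. D) / real (Suc N)"
        by (intro divide_right_mono sum_mono u_close) simp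
      also have "\<dots> = D" by simp
      finally show ?thesis .
    qed
    then show ?thesis
      by (auto simp: K_def abs_le_iff algebra_simps)
  qed
  have a_C: "a N \<in> C N" for N
  proof -
    have "\<bar>step_mean (\<lambda>x. a N (g \<otimes> x)) - a N g\<bar> \<le> D / real (Suc N)" if g: "g \<in> carrier G" for g
    proof -
      have "(\<Sum>x\<in>S. a N (g \<otimes> x)) = (\<Sum>j<Suc N. \<Sum>x\<in>S. u j (g \<otimes> x)) / real (Suc N)"
        unfolding a_def sum_divide_distrib[symmetric] by (subst sum.swap) (rule refl)
      then have "step_mean (\<lambda>x. a N (g \<otimes> x)) = (\<Sum>j<Suc N. step_mean (\<lambda>x. u j (g \<otimes> x))) / real (Suc N)"
        unfolding step_mean_def sum_divide_distrib[symmetric]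
        by (simp only: divide_divide_eq_left mult.commute)
      also have "\<dots> = (\<Sum>j<Suc N. u (Suc j) g) / real (Suc N)"
        by (simp only: u_step[OF g])
      finally have "step_mean (\<lambda>x. a N (g \<otimes> x)) - a N g = (\<Sum>j<Suc N. u (Suc j) g - u j g) / real (Suc N)"
        unfolding a_def sum_subtractf diff_divide_distrib by simp
      also have "\<dots> = (u (Suc N) g - \<phi> g) / real (Suc N)"
        using g by (simp only: sum_lessThan_telescope[of "\<lambda>j. u j g" "Suc N"]) (simp add: u_def del: walk_mean.simps(2))
      also have "\<bar>\<dots>\<bar> \<le> D / real (Suc N)"
        unfolding abs_divide abs_of_nat by (intro divide_right_mono u_close) simp
      finally show ?thesis .
    qed
    then show ?thesis by (simp add: C_def)
  qed
  have C_mono: "C N \<subseteq> C N'" if "N' \<le> N" for N N'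
  proof -
    have "D / real (Suc N) \<le> D / real (Suc N')"
      using that D by (intro divide_left_mono) auto
    then show ?thesis unfolding C_def by (auto intro: order_trans)
  qed
  have "K \<inter> (\<Inter>N\<in>UNIV. C N) \<noteq> {}"
  proof (rule compact_imp_fip_image[OF compact closed])
    fix I :: "nat set" assume I: "finite I"
    have "a (Max (insert 0 I)) \<in> C N" if "N \<in> I" for N
      using a_C C_mono[of N "Max (insert 0 I)"] that I by auto
    then show "K \<inter> (\<Inter>N\<in>I. C N) \<noteq> {}"
      using a_K by blast
  qed
  then obtain \<psi> where \<psi>: "\<psi> \<in> K" "\<And>N. \<psi> \<in> C N" by blast
  have "harmonic \<psi>"
    unfolding harmonic_def
  proof
    fix g assume g: "g \<in> carrier G"
    have "\<bar>step_mean (\<lambda>x. \<psi> (g \<otimes> x)) - \<psi> g\<bar> \<le> D / real (Suc N)" for N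
      using \<psi>(2)[of N] g unfolding C_def by blast
    then have "\<bar>step_mean (\<lambda>x. \<psi> (g \<otimes> x)) - \<psi> g\<bar> \<le> 0"
      by (intro LIMSEQ_le_const[OF lim_const_over_n[THEN LIMSEQ_Suc, of D]]) blast
    then show "step_mean (\<lambda>x. \<psi> (g \<otimes> x)) = \<psi> g" by simp
  qed
  moreover have "\<bar>\<psi> g - \<phi> g\<bar> \<le> D" for g
  proof -
    have "\<psi> g \<in> {\<phi> g - D..\<phi> g + D}"
      using \<psi>(1) unfolding K_def by (rule PiE_mem) simp
    then show ?thesis by (simp add: abs_le_iff)
  qed
  ultimately show ?thesis using that by blast
qed

text \<open>
  Along the walk a harmonic function is a martingale; with increments bounded by \<open>C\<close> its second
  moment grows at most linearly and its fourth moment at most quadratically. In the expansion of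
  \<open>(p + d)\<^sup>4\<close> the term linear in the increment \<open>d\<close> has mean zero and the cubic one is absorbed
  into the others by \<open>2 \<bar>p\<bar> C\<^sup>3 \<le> p\<^sup>2 C\<^sup>2 + C\<^sup>4\<close>.
\<close>

lemma martingale_moments:
  assumes harm: "harmonic \<psi>" and one: "\<bar>\<psi> \<one>\<bar> \<le> C"
    and incr: "\<And>g x. g \<in> carrier G \<Longrightarrow> x \<in> S \<Longrightarrow> \<bar>\<psi> (g \<otimes> x) - \<psi> g\<bar> \<le> C"
  shows "E n (\<lambda>g. \<psi> g ^ 2) \<le> C ^ 2 * (real n + 1)"
    and "E n (\<lambda>g. \<psi> g ^ 4) \<le> 11 * C ^ 4 * (real n + 1) ^ 2"
proof -
  have C: "0 \<le> C" using one by linarith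
  have zero: "step_mean (\<lambda>x. \<psi> (g \<otimes> x) - \<psi> g) = 0" if "g \<in> carrier G" for g
    using harm that step_mean_add[of "\<lambda>x. \<psi> (g \<otimes> x)" "\<lambda>x. - \<psi> g"]
    by (simp add: harmonic_def step_mean_const)
  have step: "step_mean (\<lambda>x. \<psi> (g \<otimes> x) ^ k) \<le> c" if g: "g \<in> carrier G"
    and bound: "\<And>x. x \<in> S \<Longrightarrow> \<psi> (g \<otimes> x) ^ k \<le> c + b * (\<psi> (g \<otimes> x) - \<psi> g)" for g k b c
  proof -
    have "step_mean (\<lambda>x. \<psi> (g \<otimes> x) ^ k) \<le> step_mean (\<lambda>x. c + b * (\<psi> (g \<otimes> x) - \<psi> g))"
      by (rule step_mean_mono[OF bound])
    also have "\<dots> = c"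
      by (simp only: step_mean_add step_mean_scale step_mean_const zero[OF g])
    finally show ?thesis by simp
  qed
  show second: "E n (\<lambda>g. \<psi> g ^ 2) \<le> C ^ 2 * (real n + 1)" for n
  proof (induction n)
    case 0
    show ?case using power_mono[OF one, of 2] by simp
  next
    case (Suc n)
    have "step_mean (\<lambda>x. \<psi> (g \<otimes> x) ^ 2) \<le> \<psi> g ^ 2 + C ^ 2" if g: "g \<in> carrier G" for g
    proof (rule step[OF g, where b = "2 * \<psi> g"])
      fix x assume "x \<in> S"
      define d where "d = \<psi> (g \<otimes> x) - \<psi> g"
      have "d ^ 2 \<le> C ^ 2"
        using power_mono[OF incr[OF g \<open>x \<in> S\<close>], of 2] by (simp add: d_def)
      moreover have "\<psi> (g \<otimes> x) = \<psi> g + d" by (simp add: d_def)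
      ultimately show "\<psi> (g \<otimes> x) ^ 2 \<le> \<psi> g ^ 2 + C ^ 2 + 2 * \<psi> g * (\<psi> (g \<otimes> x) - \<psi> g)"
        by (simp add: power2_sum)
    qed
    then have "E (Suc n) (\<lambda>g. \<psi> g ^ 2) \<le> E n (\<lambda>g. \<psi> g ^ 2 + C ^ 2)"
      unfolding mean_Suc by (rule mean_mono)
    also have "\<dots> = E n (\<lambda>g. \<psi> g ^ 2) + C ^ 2"
      by (simp add: mean_add mean_const)
    finally show ?case using Suc by (simp add: algebra_simps)
  qed
  show "E n (\<lambda>g. \<psi> g ^ 4) \<le> 11 * C ^ 4 * (real n + 1) ^ 2"
  proof (induction n)
    case 0
    have "\<psi> \<one> ^ 4 \<le> C ^ 4"
      using power_mono[OF one, of 4] by (simp add: power_even_abs)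
    also have "C ^ 4 \<le> 11 * C ^ 4 * (real 0 + 1) ^ 2" by simp
    finally show ?case by simp
  next
    case (Suc n)
    have "step_mean (\<lambda>x. \<psi> (g \<otimes> x) ^ 4) \<le> \<psi> g ^ 4 + 8 * C ^ 2 * \<psi> g ^ 2 + 3 * C ^ 4" if g: "g \<in> carrier G" for g
    proof (rule step[OF g, where b = "4 * \<psi> g ^ 3"])
      fix x assume x: "x \<in> S"
      define d p where "d = \<psi> (g \<otimes> x) - \<psi> g" and "p = \<psi> g"
      have d: "\<bar>d\<bar> \<le> C" using incr[OF g x] by (simp add: d_def)
      have "d ^ 2 \<le> C ^ 2"
        using power_mono[OF d, of 2] by simp
      then have 1: "6 * (p ^ 2 * d ^ 2) \<le> 6 * (p ^ 2 * C ^ 2)"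
        by (simp add: mult_left_mono)
      have 2: "d ^ 4 \<le> C ^ 4"
        using power_mono[OF d, of 4] by (simp add: power_even_abs)
      have "p * d ^ 3 \<le> \<bar>p\<bar> * C ^ 3"
      proof -
        have "p * d ^ 3 \<le> \<bar>p\<bar> * \<bar>d\<bar> ^ 3"
          by (metis abs_ge_self abs_mult power_abs)
        also have "\<dots> \<le> \<bar>p\<bar> * C ^ 3"
          using d by (intro mult_left_mono power_mono) auto
        finally show ?thesis .
      qed
      moreover have "0 \<le> (\<bar>p\<bar> * C - C ^ 2) ^ 2" by simp
      then have "2 * (\<bar>p\<bar> * C ^ 3) \<le> p ^ 2 * C ^ 2 + C ^ 4"
        by (simp add: power2_diff power_mult_distrib power2_eq_square power3_eq_cube power4_eq_xxxx algebra_simps)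
      ultimately have 3: "4 * (p * d ^ 3) \<le> 2 * (p ^ 2 * C ^ 2) + 2 * C ^ 4"
        by linarith
      have "(p + d) ^ 4 = p ^ 4 + 4 * p ^ 3 * d + 6 * (p ^ 2 * d ^ 2) + 4 * (p * d ^ 3) + d ^ 4"
        by (simp add: power2_eq_square power3_eq_cube power4_eq_xxxx algebra_simps)
      then have "(p + d) ^ 4 \<le> p ^ 4 + 8 * C ^ 2 * p ^ 2 + 3 * C ^ 4 + 4 * p ^ 3 * d"
        using 1 2 3 by (simp add: algebra_simps)
      then show "\<psi> (g \<otimes> x) ^ 4 \<le> \<psi> g ^ 4 + 8 * C ^ 2 * \<psi> g ^ 2 + 3 * C ^ 4 + 4 * \<psi> g ^ 3 * (\<psi> (g \<otimes> x) - \<psi> g)"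
        by (simp add: d_def p_def)
    qed
    then have "E (Suc n) (\<lambda>g. \<psi> g ^ 4) \<le> E n (\<lambda>g. \<psi> g ^ 4 + 8 * C ^ 2 * \<psi> g ^ 2 + 3 * C ^ 4)"
      unfolding mean_Suc by (rule mean_mono)
    also have "\<dots> = E n (\<lambda>g. \<psi> g ^ 4) + 8 * C ^ 2 * E n (\<lambda>g. \<psi> g ^ 2) + 3 * C ^ 4"
      by (simp only: mean_add mean_const mean_scale)
    also have "\<dots> \<le> 11 * C ^ 4 * (real n + 1) ^ 2 + 8 * C ^ 2 * (C ^ 2 * (real n + 1)) + 3 * C ^ 4"
      by (intro add_mono Suc mult_left_mono second) auto
    also have "\<dots> \<le> 11 * C ^ 4 * (real (Suc n) + 1) ^ 2"
    proof -
      have "11 * (real n + 1) ^ 2 + 8 * (real n + 1) + 3 \<le> 11 * (real (Suc n) + 1) ^ 2"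
        by (simp add: power2_eq_square algebra_simps)
      then have "C ^ 4 * (11 * (real n + 1) ^ 2 + 8 * (real n + 1) + 3) \<le> C ^ 4 * (11 * (real (Suc n) + 1) ^ 2)"
        by (rule mult_left_mono) simp
      moreover have "C ^ 2 * C ^ 2 = C ^ 4" by (simp flip: power_add)
      ultimately show ?thesis by (simp add: algebra_simps)
    qed
    finally show ?case .
  qed
qed

text \<open>A homogeneous quasimorphism inherits the moment bounds of its harmonic representative.\<close>

lemma quasimorphism_moments_le:
  assumes \<phi>: "\<phi> \<in> homogeneous_quasimorphisms G"
  obtains C where "0 < C" "\<And>n. 1 \<le> n \<Longrightarrow> E n (\<lambda>g. \<phi> g ^ 2) \<le> C * real n"
    "\<And>n. 1 \<le> n \<Longrightarrow> E n (\<lambda>g. \<phi> g ^ 4) \<le> C * real n ^ 2"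
proof -
  obtain D where D: "defect_le G \<phi> D"
    by (rule homogeneous_quasimorphism_defect[OF \<phi>])
  obtain \<psi> where \<psi>: "harmonic \<psi>" "\<And>g. g \<in> carrier G \<Longrightarrow> \<bar>\<psi> g - \<phi> g\<bar> \<le> D"
    by (rule harmonic_representative[OF \<phi> D]) (rule that)
  define C where "C = 3 * D + (\<Sum>x\<in>S. \<bar>\<phi> x\<bar>)"
  have D0: "0 \<le> D" by (rule defect_le_nonneg[OF D])
  have sum: "0 \<le> (\<Sum>x\<in>S. \<bar>\<phi> x\<bar>)" by (intro sum_nonneg) simp
  have one: "\<bar>\<psi> \<one>\<bar> \<le> C"
    using \<psi>(2)[OF one_closed] homogeneous_quasimorphism_pow(3)[OF \<phi> one_closed] D0 sum
    unfolding C_def by linarith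
  have incr: "\<bar>\<psi> (g \<otimes> x) - \<psi> g\<bar> \<le> C" if "g \<in> carrier G" "x \<in> S" for g x
  proof -
    have "\<bar>\<phi> x\<bar> \<le> (\<Sum>x\<in>S. \<bar>\<phi> x\<bar>)"
      using finite_S that by (intro member_le_sum) auto
    moreover have "\<bar>\<psi> (g \<otimes> x) - \<phi> (g \<otimes> x)\<bar> \<le> D"
      using that by (intro \<psi>(2)) auto
    moreover have "\<bar>\<psi> g - \<phi> g\<bar> \<le> D"
      using that by (intro \<psi>(2)) auto
    moreover have "\<bar>\<phi> (g \<otimes> x) - \<phi> g - \<phi> x\<bar> \<le> D"
      using that by (intro defect_leD[OF D]) auto
    ultimately show ?thesis unfolding C_def by linarith
  qed
  note moments = martingale_moments[of \<psi> C, OF \<psi>(1) one incr]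
  define K where "K = 4 * C ^ 2 + 2 * D ^ 2 + 352 * C ^ 4 + 8 * D ^ 4 + 1"
  have sq: "(p :: real) ^ 2 \<le> 2 * q ^ 2 + 2 * D ^ 2" if "\<bar>q - p\<bar> \<le> D" for p q
  proof -
    have "(q - p) ^ 2 \<le> D ^ 2"
      using power_mono[OF that, of 2] by simp
    moreover have "0 \<le> (2 * q - p) ^ 2" by simp
    ultimately show ?thesis by (simp add: power2_eq_square algebra_simps)
  qed
  have E2: "E n (\<lambda>g. \<phi> g ^ 2) \<le> 2 * E n (\<lambda>g. \<psi> g ^ 2) + 2 * D ^ 2" for n
  proof -
    have "E n (\<lambda>g. \<phi> g ^ 2) \<le> E n (\<lambda>g. 2 * \<psi> g ^ 2 + 2 * D ^ 2)"
      by (intro mean_mono sq \<psi>(2))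
    then show ?thesis by (simp only: mean_add mean_scale mean_const)
  qed
  have E4: "E n (\<lambda>g. \<phi> g ^ 4) \<le> 8 * E n (\<lambda>g. \<psi> g ^ 4) + 8 * D ^ 4" for n
  proof -
    have "\<phi> g ^ 4 \<le> 8 * \<psi> g ^ 4 + 8 * D ^ 4" if g: "g \<in> carrier G" for g
    proof -
      have "(\<phi> g ^ 2) ^ 2 \<le> (2 * \<psi> g ^ 2 + 2 * D ^ 2) ^ 2"
        by (intro power_mono sq \<psi>(2) g) simp
      moreover have "0 \<le> (\<psi> g ^ 2 - D ^ 2) ^ 2" by simp
      ultimately show ?thesis
        by (simp add: power2_eq_square power4_eq_xxxx algebra_simps)
    qed
    then have "E n (\<lambda>g. \<phi> g ^ 4) \<le> E n (\<lambda>g. 8 * \<psi> g ^ 4 + 8 * D ^ 4)"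
      by (rule mean_mono)
    then show ?thesis by (simp only: mean_add mean_scale mean_const)
  qed
  have "E n (\<lambda>g. \<phi> g ^ 2) \<le> K * real n" if n: "1 \<le> n" for n
  proof -
    have "E n (\<lambda>g. \<phi> g ^ 2) \<le> 2 * (C ^ 2 * (real n + 1)) + 2 * D ^ 2"
      using E2[of n] moments(1)[of n] by linarith
    also have "\<dots> \<le> 2 * (C ^ 2 * (2 * real n)) + 2 * D ^ 2 * real n"
      using n by (intro add_mono mult_left_mono) (auto simp: mult_le_cancel_left1)
    also have "\<dots> = (4 * C ^ 2 + 2 * D ^ 2) * real n"
      by (simp add: algebra_simps)
    also have "\<dots> \<le> K * real n"
      unfolding K_def by (intro mult_right_mono) auto
    finally show ?thesis .
  qed
  moreover have "E n (\<lambda>g. \<phi> g ^ 4) \<le> K * real n ^ 2" if n: "1 \<le> n" for n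
  proof -
    have "(real n + 1) ^ 2 \<le> (2 * real n) ^ 2"
      using n by (intro power_mono) auto
    then have m: "11 * C ^ 4 * (real n + 1) ^ 2 \<le> 11 * C ^ 4 * (4 * real n ^ 2)"
      by (intro mult_left_mono) (auto simp: power_mult_distrib)
    have "1 \<le> real n ^ 2" using n by (simp add: one_le_power)
    then have d: "8 * D ^ 4 \<le> 8 * D ^ 4 * real n ^ 2"
      by (simp add: mult_le_cancel_left1)
    have "E n (\<lambda>g. \<phi> g ^ 4) \<le> 8 * (11 * C ^ 4 * (4 * real n ^ 2)) + 8 * D ^ 4 * real n ^ 2"
      using E4[of n] moments(2)[of n] m d by linarith
    also have "\<dots> = (352 * C ^ 4 + 8 * D ^ 4) * real n ^ 2"
      by (simp add: algebra_simps)
    also have "\<dots> \<le> K * real n ^ 2"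
      unfolding K_def by (intro mult_right_mono) auto
    finally show ?thesis .
  qed
  moreover have "0 < K"
    unfolding K_def by (intro add_nonneg_pos add_nonneg_nonneg) auto
  ultimately show ?thesis using that by blast
qed

lemma mean_ge_word:
  assumes "set xs \<subseteq> S" "\<And>g. g \<in> carrier G \<Longrightarrow> 0 \<le> f g"
  shows "f (foldr (mult G) xs \<one>) / real (card S) ^ length xs \<le> E (length xs) f"
  using assms
proof (induction xs arbitrary: f)
  case (Cons x xs)
  have x: "x \<in> S" using Cons.prems by simp
  let ?g = "foldr (mult G) xs \<one>"
  have "f (x \<otimes> ?g) / real (card S) ^ length xs \<le> E (length xs) (\<lambda>g. f (x \<otimes> g))"
    using Cons.prems by (intro Cons.IH) auto
  also have "\<dots> \<le> (\<Sum>x\<in>S. E (length xs) (\<lambda>g. f (x \<otimes> g)))"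
    using x finite_S Cons.prems by (intro member_le_sum) (auto intro!: mean_nonneg)
  finally have "f (x \<otimes> ?g) / real (card S) ^ length xs / real (card S) \<le> E (Suc (length xs)) f"
    unfolding mean_Suc' step_mean_def by (intro divide_right_mono) auto
  then show ?case by (simp add: ac_simps)
qed simp

lemma ex_word:
  assumes "g \<in> generate G S"
  shows "\<exists>xs. set xs \<subseteq> S \<and> g = foldr (mult G) xs \<one>"
  using assms
proof (induction rule: generate.induct)
  case one
  show ?case by (intro exI[of _ "[]"]) simp
next
  case (incl h)
  then show ?case by (intro exI[of _ "[h]"]) simp
next
  case (inv h)
  then show ?case by (intro exI[of _ "[inv h]"]) (simp add: S_inv)
next
  case (eng g h)
  then obtain xs ys where *: "set xs \<subseteq> S" "g = foldr (mult G) xs \<one>" "set ys \<subseteq> S" "h = foldr (mult G) ys \<one>"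
    by blast
  then show ?case
    using foldr_mult_append[of xs ys] S_closed by (intro exI[of _ "xs @ ys"]) auto
qed

text \<open>
  Nondegeneracy: fix a word of length \<open>l\<close> on which \<open>\<bar>\<phi>\<bar>\<close> is at least \<open>3D + 1\<close>. From every
  position the next \<open>l\<close> steps follow this word with a fixed positive probability, and then they
  move the harmonic representative by at least 1. As martingale increments are orthogonal, the
  variance gains a fixed amount in every \<open>l\<close> steps.
\<close>

lemma quasimorphism_variance_ge:
  assumes \<phi>: "\<phi> \<in> homogeneous_quasimorphisms G" "\<phi> \<noteq> 0" and gen: "generate G S = carrier G"
  obtains c N where "0 < c" "\<And>n. N \<le> n \<Longrightarrow> c * real n \<le> E n (\<lambda>g. \<phi> g ^ 2)"
proof -
  obtain D where D: "defect_le G \<phi> D"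
    by (rule homogeneous_quasimorphism_defect[OF \<phi>(1)])
  have D0: "0 \<le> D" by (rule defect_le_nonneg[OF D])
  obtain \<psi> where \<psi>: "harmonic \<psi>" "\<And>g. g \<in> carrier G \<Longrightarrow> \<bar>\<psi> g - \<phi> g\<bar> \<le> D"
    by (rule harmonic_representative[OF \<phi>(1) D]) (rule that)
  obtain g0 where "\<phi> g0 \<noteq> 0" using \<phi>(2) by (auto simp: fun_eq_iff)
  then have g0: "g0 \<in> carrier G" "0 < \<bar>\<phi> g0\<bar>"
    using \<phi>(1) by (auto simp: homogeneous_quasimorphisms_def)
  obtain k :: nat where k: "3 * D + 1 < real k * \<bar>\<phi> g0\<bar>"
    using reals_Archimedean3[OF g0(2)] by blast
  define h where "h = g0 [^] k"
  have h: "h \<in> carrier G" "3 * D + 1 \<le> \<bar>\<phi> h\<bar>"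
    using g0 k homogeneous_quasimorphism_pow(1)[OF \<phi>(1) g0(1), of k] by (auto simp: h_def abs_mult)
  obtain xs where xs: "set xs \<subseteq> S" "h = foldr (mult G) xs \<one>"
    using ex_word[of h] h gen by auto
  define l where "l = length xs"
  have "xs \<noteq> []"
    using xs h D0 homogeneous_quasimorphism_pow(3)[OF \<phi>(1) one_closed] by auto
  then have l: "0 < l" by (simp add: l_def)
  define \<delta> where "\<delta> = 1 / real (card S) ^ l"
  have \<delta>: "0 < \<delta>" using card_S_pos by (simp add: \<delta>_def)
  have move: "1 \<le> (\<psi> (g \<otimes> h) - \<psi> g) ^ 2" if g: "g \<in> carrier G" for g
  proof -
    have "1 \<le> \<bar>\<psi> (g \<otimes> h) - \<psi> g\<bar>"
      using \<psi>(2)[OF g] \<psi>(2)[OF m_closed[OF g h(1)]] defect_leD[OF D g h(1)] h(2) by linarith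
    from power_mono[OF this, of 2] show ?thesis by simp
  qed
  have gain: "\<psi> g ^ 2 + \<delta> \<le> E l (\<lambda>h. \<psi> (g \<otimes> h) ^ 2)" if g: "g \<in> carrier G" for g
  proof -
    have "\<delta> \<le> (\<psi> (g \<otimes> h) - \<psi> g) ^ 2 / real (card S) ^ l"
      unfolding \<delta>_def by (intro divide_right_mono move g) simp
    also have "\<dots> \<le> E l (\<lambda>h. (\<psi> (g \<otimes> h) - \<psi> g) ^ 2)"
      unfolding l_def xs(2) by (rule mean_ge_word[OF xs(1), of "\<lambda>h. (\<psi> (g \<otimes> h) - \<psi> g) ^ 2"]) simp
    also have "\<dots> = E l (\<lambda>h. \<psi> (g \<otimes> h) ^ 2 + ((- 2 * \<psi> g) * \<psi> (g \<otimes> h) + \<psi> g ^ 2))"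
      by (rule mean_cong) (simp add: power2_eq_square algebra_simps)
    also have "\<dots> = E l (\<lambda>h. \<psi> (g \<otimes> h) ^ 2) - \<psi> g ^ 2"
      unfolding mean_add mean_scale mean_const mean_harmonic[OF \<psi>(1) g] by (simp add: power2_eq_square)
    finally show ?thesis by simp
  qed
  have growth: "\<delta> * real k \<le> E (r + k * l) (\<lambda>g. \<psi> g ^ 2)" for k r
  proof (induction k)
    case 0
    show ?case using mean_nonneg[of "\<lambda>g. \<psi> g ^ 2"] by simp
  next
    case (Suc k)
    have "E (r + k * l) (\<lambda>g. \<psi> g ^ 2) + \<delta> = E (r + k * l) (\<lambda>g. \<psi> g ^ 2 + \<delta>)"
      by (simp only: mean_add mean_const)
    also have "\<dots> \<le> E (r + k * l) (\<lambda>g. E l (\<lambda>h. \<psi> (g \<otimes> h) ^ 2))"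
      by (rule mean_mono[OF gain])
    also have "\<dots> = E (r + k * l + l) (\<lambda>g. \<psi> g ^ 2)"
      by (rule mean_split[symmetric])
    finally show ?case using Suc by (simp add: algebra_simps)
  qed
  have E2: "E n (\<lambda>g. \<psi> g ^ 2) \<le> 2 * E n (\<lambda>g. \<phi> g ^ 2) + 2 * D ^ 2" for n
  proof -
    have "\<psi> g ^ 2 \<le> 2 * \<phi> g ^ 2 + 2 * D ^ 2" if "g \<in> carrier G" for g
    proof -
      have "(\<psi> g - \<phi> g) ^ 2 \<le> D ^ 2"
        using power_mono[OF \<psi>(2)[OF that], of 2] by simp
      moreover have "0 \<le> (2 * \<phi> g - \<psi> g) ^ 2" by simp
      ultimately show ?thesis by (simp add: power2_eq_square algebra_simps)
    qed
    then have "E n (\<lambda>g. \<psi> g ^ 2) \<le> E n (\<lambda>g. 2 * \<phi> g ^ 2 + 2 * D ^ 2)"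
      by (rule mean_mono)
    then show ?thesis by (simp only: mean_add mean_scale mean_const)
  qed
  define c where "c = \<delta> / (4 * real l)"
  have c: "0 < c" using \<delta> l by (simp add: c_def)
  define N where "N = nat \<lceil>(\<delta> + 2 * D ^ 2) / (2 * c)\<rceil>"
  have "c * real n \<le> E n (\<lambda>g. \<phi> g ^ 2)" if n: "N \<le> n" for n
  proof -
    have "(\<delta> + 2 * D ^ 2) / (2 * c) \<le> real n"
      using n unfolding N_def by linarith
    then have large: "\<delta> + 2 * D ^ 2 \<le> 2 * c * real n"
      using c by (simp add: field_simps)
    have "real n < (real (n div l) + 1) * real l"
    proof -
      have "n < (n div l + 1) * l"
        using l by (metis Suc_eq_plus1 dividend_less_div_times mult.commute mult_Suc_right add.commute)
      then show ?thesis by (metis of_nat_1 of_nat_add of_nat_less_iff of_nat_mult)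
    qed
    then have "\<delta> * real n \<le> \<delta> * ((real (n div l) + 1) * real l)"
      using \<delta> by (intro mult_left_mono) auto
    then have "4 * c * real n \<le> \<delta> * (real (n div l) + 1)"
      unfolding c_def using l by (simp add: field_simps)
    moreover have "\<delta> * real (n div l) \<le> E n (\<lambda>g. \<psi> g ^ 2)"
      using growth[of "n div l" "n mod l"] by simp
    ultimately show ?thesis
      using E2[of n] large by (simp add: algebra_simps)
  qed
  then show ?thesis using that c by blast
qed

end

section \<open>Anticoncentration\<close>

lemma cos_ge_quadratic: "1 - x ^ 2 / 2 \<le> cos (x::real)"
proof -
  have "\<bar>sin (x / 2)\<bar> \<le> \<bar>x / 2\<bar>" by (rule abs_sin_x_le_abs_x)
  from power_mono[OF this, of 2] have "(sin (x / 2)) ^ 2 \<le> x ^ 2 / 4"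
    by (simp add: power_divide)
  moreover have "cos x = 1 - 2 * (sin (x / 2)) ^ 2"
    using cos_double_sin[of "x / 2"] by simp
  ultimately show ?thesis by simp
qed

lemma cos_le_quartic: "cos (x::real) \<le> 1 - x ^ 2 / 2 + x ^ 4 / 24"
proof -
  obtain t where t: "cos x = (\<Sum>m<4. cos_coeff m * x ^ m) + (cos (t + 1 / 2 * real 4 * pi) / fact 4) * x ^ 4"
    using Maclaurin_cos_expansion[of x 4] by blast
  have "cos (t + 1 / 2 * real 4 * pi) * x ^ 4 \<le> 1 * x ^ 4"
    by (intro mult_right_mono) auto
  moreover have "(fact 4 :: real) = 24"
    by (simp add: fact_numeral)
  moreover have "{..<4} = {0, 1, 2, 3 :: nat}" by auto
  then have "(\<Sum>m<4. cos_coeff m * x ^ m) = 1 - x ^ 2 / 2"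
    by (simp add: cos_coeff_def)
  ultimately show ?thesis
    unfolding t by simp
qed

text \<open>
  The (unnormalized) Fejer kernel: a nonnegative trigonometric polynomial that is large near zero.
  It turns upper bounds on a characteristic function at finitely many points into upper bounds on the
  probability of an interval.
\<close>

definition fejer :: "nat \<Rightarrow> real \<Rightarrow> real \<Rightarrow> real" where
  "fejer J \<theta> x = (\<Sum>i<J. \<Sum>j<J. cos ((real i - real j) * \<theta> * x))"

lemma fejer_nonneg: "0 \<le> fejer J \<theta> x"
proof -
  have "fejer J \<theta> x = (\<Sum>i<J. \<Sum>j<J. cos (real i * \<theta> * x) * cos (real j * \<theta> * x)) +
      (\<Sum>i<J. \<Sum>j<J. sin (real i * \<theta> * x) * sin (real j * \<theta> * x))"
    unfolding fejer_def by (simp only: left_diff_distrib cos_diff sum.distrib)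
  also have "\<dots> = (\<Sum>i<J. cos (real i * \<theta> * x)) ^ 2 + (\<Sum>i<J. sin (real i * \<theta> * x)) ^ 2"
    by (simp only: power2_eq_square sum_product)
  finally show ?thesis by simp
qed

lemma fejer_ge:
  assumes "real J * \<bar>\<theta>\<bar> * \<bar>x\<bar> \<le> 1"
  shows "real J ^ 2 / 2 \<le> fejer J \<theta> x"
proof -
  have "1 / 2 \<le> cos ((real i - real j) * \<theta> * x)" if "i < J" "j < J" for i j
  proof -
    have "\<bar>(real i - real j) * \<theta> * x\<bar> = \<bar>real i - real j\<bar> * (\<bar>\<theta>\<bar> * \<bar>x\<bar>)"
      by (simp add: abs_mult mult.assoc)
    also have "\<dots> \<le> real J * (\<bar>\<theta>\<bar> * \<bar>x\<bar>)"
      using that by (intro mult_right_mono) auto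
    also have "\<dots> \<le> 1"
      using assms by (simp add: mult.assoc)
    finally have "\<bar>(real i - real j) * \<theta> * x\<bar> \<le> 1" .
    from power_mono[OF this, of 2] have "((real i - real j) * \<theta> * x) ^ 2 \<le> 1" by simp
    then show ?thesis
      using cos_ge_quadratic[of "(real i - real j) * \<theta> * x"] by linarith
  qed
  then have "(\<Sum>i<J. \<Sum>j<J. 1 / 2) \<le> fejer J \<theta> x"
    unfolding fejer_def by (intro sum_mono) auto
  then show ?thesis by (simp add: power2_eq_square)
qed

context symmetric_walk
begin

text \<open>
  \<open>block_mean \<phi> m k F u\<close> is the expectation of \<open>F (u + Y\<^sub>1 + \<dots> + Y\<^sub>k)\<close> for independent
  \<open>Y\<^sub>i\<close> distributed as \<open>\<phi>\<close> at time \<open>m\<close> of the walk.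
\<close>

primrec block_mean :: "('a \<Rightarrow> real) \<Rightarrow> nat \<Rightarrow> nat \<Rightarrow> (real \<Rightarrow> real) \<Rightarrow> real \<Rightarrow> real" where
  "block_mean \<phi> m 0 F u = F u"
| "block_mean \<phi> m (Suc k) F u = E m (\<lambda>g. block_mean \<phi> m k F (u + \<phi> g))"

lemma block_mean_sum:
  assumes "finite I"
  shows "block_mean \<phi> m k (\<lambda>x. \<Sum>i\<in>I. F i x) u = (\<Sum>i\<in>I. block_mean \<phi> m k (F i) u)"
  using assms by (induction k arbitrary: u) (simp_all add: mean_sum)

text \<open>The symmetric distribution of \<open>\<phi>\<close> makes its characteristic function real.\<close>

lemma block_mean_cos:
  assumes \<phi>: "\<phi> \<in> homogeneous_quasimorphisms G"
  shows "block_mean \<phi> m k (\<lambda>x. cos (t * x)) u = E m (\<lambda>g. cos (t * \<phi> g)) ^ k * cos (t * u)"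
proof (induction k arbitrary: u)
  case (Suc k)
  have odd: "E m (\<lambda>g. sin (t * \<phi> g)) = 0"
    by (rule mean_odd) (simp add: homogeneous_quasimorphism_pow(2)[OF \<phi>])
  let ?c = "E m (\<lambda>g. cos (t * \<phi> g))"
  have "block_mean \<phi> m (Suc k) (\<lambda>x. cos (t * x)) u =
      E m (\<lambda>g. ?c ^ k * (cos (t * u) * cos (t * \<phi> g) - sin (t * u) * sin (t * \<phi> g)))"
    by (simp add: Suc.IH cos_add distrib_left)
  also have "\<dots> = ?c ^ k * (cos (t * u) * ?c - sin (t * u) * E m (\<lambda>g. sin (t * \<phi> g)))"
    by (simp only: mean_scale mean_diff)
  finally show ?case by (simp add: odd)
qed simp

text \<open>
  The value of a quasimorphism at time \<open>q + k m\<close> is the sum of its values on \<open>k\<close> consecutive blocks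
  of length \<open>m\<close>, up to an error bounded in terms of \<open>q\<close> and \<open>k\<close> alone.
\<close>

lemma mean_le_block_mean:
  assumes D: "defect_le G \<phi> D" and y: "y \<in> carrier G" "\<bar>\<phi> y - u\<bar> \<le> r"
    and dom: "\<And>v w. \<bar>v - w\<bar> \<le> r + real k * D \<Longrightarrow> h v \<le> F w"
  shows "E (k * m) (\<lambda>g. h (\<phi> (y \<otimes> g))) \<le> block_mean \<phi> m k F u"
  using y dom
proof (induction k arbitrary: y u r)
  case 0
  then show ?case by simp
next
  case (Suc k)
  have "E (Suc k * m) (\<lambda>g. h (\<phi> (y \<otimes> g))) = E m (\<lambda>b. E (k * m) (\<lambda>g. h (\<phi> (y \<otimes> (b \<otimes> g)))))"
    unfolding mult_Suc by (rule mean_split)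
  also have "\<dots> \<le> E m (\<lambda>b. block_mean \<phi> m k F (u + \<phi> b))"
  proof (rule mean_mono)
    fix b assume b: "b \<in> carrier G"
    have "E (k * m) (\<lambda>g. h (\<phi> (y \<otimes> (b \<otimes> g)))) = E (k * m) (\<lambda>g. h (\<phi> (y \<otimes> b \<otimes> g)))"
      using b Suc.prems(1) by (intro mean_cong) (simp add: m_assoc)
    also have "\<dots> \<le> block_mean \<phi> m k F (u + \<phi> b)"
    proof (rule Suc.IH[where r = "r + D"])
      show "\<bar>\<phi> (y \<otimes> b) - (u + \<phi> b)\<bar> \<le> r + D"
        using defect_leD[OF D Suc.prems(1) b] Suc.prems(2) by linarith
      show "h v \<le> F w" if "\<bar>v - w\<bar> \<le> r + D + real k * D" for v w
        using that by (intro Suc.prems(3)) (simp add: algebra_simps)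
    qed (use b Suc.prems(1) in simp)
    finally show "E (k * m) (\<lambda>g. h (\<phi> (y \<otimes> (b \<otimes> g)))) \<le> block_mean \<phi> m k F (u + \<phi> b)" .
  qed
  finally show ?case by simp
qed

lemma mean_le_block_mean_remainder:
  assumes D: "defect_le G \<phi> D" and L: "\<And>x. x \<in> S \<Longrightarrow> \<bar>\<phi> x\<bar> \<le> L"
    and y: "y \<in> carrier G" "\<bar>\<phi> y\<bar> \<le> r"
    and dom: "\<And>v w. \<bar>v - w\<bar> \<le> r + real q * (D + L) + real k * D \<Longrightarrow> h v \<le> F w"
  shows "E (q + k * m) (\<lambda>g. h (\<phi> (y \<otimes> g))) \<le> block_mean \<phi> m k F 0"
  using y dom
proof (induction q arbitrary: y r)
  case 0
  then show ?case
    using mean_le_block_mean[OF D, of y 0 r k h F m] by simp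
next
  case (Suc q)
  have "E (Suc q + k * m) (\<lambda>g. h (\<phi> (y \<otimes> g))) = step_mean (\<lambda>x. E (q + k * m) (\<lambda>g. h (\<phi> (y \<otimes> (x \<otimes> g)))))"
    unfolding add_Suc by (rule mean_Suc')
  also have "\<dots> \<le> step_mean (\<lambda>x. block_mean \<phi> m k F 0)"
  proof (rule step_mean_mono)
    fix x assume x: "x \<in> S"
    have "E (q + k * m) (\<lambda>g. h (\<phi> (y \<otimes> (x \<otimes> g)))) = E (q + k * m) (\<lambda>g. h (\<phi> (y \<otimes> x \<otimes> g)))"
      using x Suc.prems(1) by (intro mean_cong) (simp add: m_assoc)
    also have "\<dots> \<le> block_mean \<phi> m k F 0"
    proof (rule Suc.IH[where r = "r + (D + L)"])
      show "\<bar>\<phi> (y \<otimes> x)\<bar> \<le> r + (D + L)"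
        using defect_leD[OF D Suc.prems(1) S_carrier[OF x]] Suc.prems(2) L[OF x] by linarith
      show "h v \<le> F w" if "\<bar>v - w\<bar> \<le> r + (D + L) + real q * (D + L) + real k * D" for v w
        using that by (intro Suc.prems(3)) (simp add: algebra_simps)
    qed (use x Suc.prems(1) in simp)
    finally show "E (q + k * m) (\<lambda>g. h (\<phi> (y \<otimes> (x \<otimes> g)))) \<le> block_mean \<phi> m k F 0" .
  qed
  finally show ?case by (simp add: step_mean_const)
qed

lemma char_bounds:
  "1 - t ^ 2 * E m (\<lambda>g. \<phi> g ^ 2) / 2 \<le> E m (\<lambda>g. cos (t * \<phi> g))"
  "E m (\<lambda>g. cos (t * \<phi> g)) \<le> 1 - t ^ 2 * E m (\<lambda>g. \<phi> g ^ 2) / 2 + t ^ 4 * E m (\<lambda>g. \<phi> g ^ 4) / 24"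
proof -
  have "E m (\<lambda>g. 1 - (t ^ 2 / 2) * \<phi> g ^ 2) \<le> E m (\<lambda>g. cos (t * \<phi> g))"
    using cos_ge_quadratic[of "t * \<phi> _"] by (intro mean_mono) (simp add: power_mult_distrib)
  then show "1 - t ^ 2 * E m (\<lambda>g. \<phi> g ^ 2) / 2 \<le> E m (\<lambda>g. cos (t * \<phi> g))"
    unfolding mean_diff mean_scale mean_const by simp
  have "E m (\<lambda>g. cos (t * \<phi> g)) \<le> E m (\<lambda>g. (1 - (t ^ 2 / 2) * \<phi> g ^ 2) + (t ^ 4 / 24) * \<phi> g ^ 4)"
    using cos_le_quartic[of "t * \<phi> _"] by (intro mean_mono) (simp add: power_mult_distrib)
  then show "E m (\<lambda>g. cos (t * \<phi> g)) \<le> 1 - t ^ 2 * E m (\<lambda>g. \<phi> g ^ 2) / 2 + t ^ 4 * E m (\<lambda>g. \<phi> g ^ 4) / 24"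
    unfolding mean_add mean_diff mean_scale mean_const by simp
qed

text \<open>
  Concentration of \<open>\<phi>\<close> at scale \<open>\<surd>n\<close> is impossible: cut the walk into a fixed number \<open>k\<close> of
  blocks of length \<open>m\<close>. The moment bounds keep the characteristic function of \<open>\<phi>\<close> on one block
  between 0 and some \<open>\<rho> < 1\<close> at the frequencies \<open>d \<theta> / \<surd>m\<close> with \<open>1 \<le> d < J\<close>, hence below
  \<open>\<rho>\<^sup>k\<close> for the whole walk, and the Fejer kernel gives the bound \<open>2 / J + 2 \<rho>\<^sup>k\<close>.
\<close>

theorem quasimorphism_anticoncentration:
  assumes \<phi>: "\<phi> \<in> homogeneous_quasimorphisms G" "\<phi> \<noteq> 0" and gen: "generate G S = carrier G"
    and \<epsilon>: "0 < \<epsilon>"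
  obtains a where "0 < a" "\<forall>\<^sub>F n in sequentially. E n (\<lambda>g. of_bool (\<bar>\<phi> g\<bar> \<le> a * sqrt (real n))) \<le> \<epsilon>"
proof -
  obtain c N where c: "0 < c" "\<And>n. N \<le> n \<Longrightarrow> c * real n \<le> E n (\<lambda>g. \<phi> g ^ 2)"
    by (rule quasimorphism_variance_ge[OF \<phi> gen]) (rule that)
  obtain C where C: "0 < C" "\<And>n. 1 \<le> n \<Longrightarrow> E n (\<lambda>g. \<phi> g ^ 2) \<le> C * real n"
    "\<And>n. 1 \<le> n \<Longrightarrow> E n (\<lambda>g. \<phi> g ^ 4) \<le> C * real n ^ 2"
    by (rule quasimorphism_moments_le[OF \<phi>(1)]) (rule that)
  obtain D where D: "defect_le G \<phi> D"
    by (rule homogeneous_quasimorphism_defect[OF \<phi>(1)])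
  have D0: "0 \<le> D" by (rule defect_le_nonneg[OF D])
  define L where "L = (\<Sum>x\<in>S. \<bar>\<phi> x\<bar>)"
  have L: "\<bar>\<phi> x\<bar> \<le> L" if "x \<in> S" for x
    unfolding L_def using finite_S that by (intro member_le_sum) auto
  have L0: "0 \<le> L" unfolding L_def by (intro sum_nonneg) simp
  \<comment> \<open>Up to the frequency \<open>\<tau> / \<surd>m\<close>, the characteristic function of one block is nonnegative, and the
    fourth-moment term is at most half of the second-moment term.\<close>
  define \<tau> where "\<tau> = sqrt (min (6 * c / C) (2 / C))"
  have \<tau>: "0 < \<tau>" "\<tau> ^ 2 * C \<le> 6 * c" "\<tau> ^ 2 * C \<le> 2"
    using c(1) C(1) by (auto simp: \<tau>_def min_def field_simps)
  define J where "J = nat \<lceil>4 / \<epsilon>\<rceil>"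
  have J: "4 / \<epsilon> \<le> real J"
    unfolding J_def by (rule real_nat_ceiling_ge)
  then have J0: "0 < real J"
    using \<epsilon> by (smt (verit) divide_pos_pos)
  define \<theta> where "\<theta> = \<tau> / real J"
  have \<theta>: "0 < \<theta>" using \<tau> J0 by (simp add: \<theta>_def)
  define \<rho> where "\<rho> = 1 - \<theta> ^ 2 * c / 4"
  have char: "0 \<le> E m (\<lambda>g. cos (t / sqrt (real m) * \<phi> g)) \<and> E m (\<lambda>g. cos (t / sqrt (real m) * \<phi> g)) \<le> \<rho>"
    if m: "N \<le> m" "1 \<le> m" and t: "\<theta> \<le> t" "t \<le> \<tau>" for m t
  proof -
    let ?s = "t / sqrt (real m)"
    have s2: "?s ^ 2 = t ^ 2 / real m"
      by (simp add: power_divide)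
    have "?s ^ 4 = (?s ^ 2) ^ 2" by (simp flip: power_mult)
    then have s4: "?s ^ 4 = t ^ 4 / real m ^ 2"
      unfolding s2 by (simp add: power_divide flip: power_mult)
    have t2: "t ^ 2 \<le> \<tau> ^ 2" "\<theta> ^ 2 \<le> t ^ 2"
      using t \<theta> by (auto intro!: power_mono)
    have tC: "t ^ 2 * C \<le> 2" "t ^ 2 * C \<le> 6 * c"
      using \<tau> t2 C(1) by (meson mult_right_mono less_imp_le order_trans)+
    have upper2: "?s ^ 2 * E m (\<lambda>g. \<phi> g ^ 2) \<le> t ^ 2 * C"
    proof -
      have "?s ^ 2 * E m (\<lambda>g. \<phi> g ^ 2) \<le> ?s ^ 2 * (C * real m)"
        using C(2)[OF m(2)] by (intro mult_left_mono) auto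
      then show ?thesis using m by (simp add: s2)
    qed
    have lower2: "t ^ 2 * c \<le> ?s ^ 2 * E m (\<lambda>g. \<phi> g ^ 2)"
    proof -
      have "?s ^ 2 * (c * real m) \<le> ?s ^ 2 * E m (\<lambda>g. \<phi> g ^ 2)"
        using c(2)[OF m(1)] by (intro mult_left_mono) auto
      then show ?thesis using m by (simp add: s2)
    qed
    have upper4: "?s ^ 4 * E m (\<lambda>g. \<phi> g ^ 4) \<le> t ^ 4 * C"
    proof -
      have "?s ^ 4 * E m (\<lambda>g. \<phi> g ^ 4) \<le> ?s ^ 4 * (C * real m ^ 2)"
        using C(3)[OF m(2)] by (intro mult_left_mono) auto
      then show ?thesis using m by (simp add: s4)
    qed
    have "t ^ 4 * C = t ^ 2 * (t ^ 2 * C)"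
      by (simp add: power2_eq_square power4_eq_xxxx)
    also have "\<dots> \<le> t ^ 2 * (6 * c)"
      by (rule mult_left_mono[OF tC(2)]) simp
    finally have t4: "t ^ 4 * C \<le> 6 * (t ^ 2 * c)" by simp
    have "\<theta> ^ 2 * c \<le> t ^ 2 * c"
      using t2 c(1) by (intro mult_right_mono) auto
    then show ?thesis
      using char_bounds[where \<phi> = \<phi> and m = m and t = ?s] upper2 lower2 upper4 t4 tC(1) unfolding \<rho>_def by linarith
  qed
  have \<rho>: "\<rho> < 1" using \<theta> c(1) by (simp add: \<rho>_def)
  have "0 \<le> \<rho>"
    using char[of "max N 1" \<tau>] \<theta> \<tau> J0 J \<epsilon> order_trans[of 0 _ \<rho>]
    by (auto simp: \<theta>_def field_simps)
  obtain k0 where k0: "\<rho> ^ k0 < \<epsilon> / 4"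
    using real_arch_pow_inv[of "\<epsilon> / 4" \<rho>] \<epsilon> \<rho> by auto
  define k where "k = Suc k0"
  have k: "0 < k" "\<rho> ^ k \<le> \<epsilon> / 4"
    using k0 \<rho> \<open>0 \<le> \<rho>\<close> mult_left_le_one_le[of "\<rho> ^ k0" \<rho>] by (auto simp: k_def)
  \<comment> \<open>The kernel is large on \<open>\<bar>w\<bar> \<le> \<surd>m / \<tau>\<close>. Half of this range covers
    \<open>a \<surd>n\<close>, as \<open>n \<le> 2 k m\<close>, and the other half covers the error \<open>R\<close> of the cutting.\<close>
  define a where "a = 1 / (2 * \<tau> * sqrt (2 * real k))"
  have a: "0 < a" using \<tau> k by (simp add: a_def)
  define R where "R = real k * (2 * D + L)"
  define m0 where "m0 = max (max N 1) (nat \<lceil>(2 * \<tau> * R) ^ 2\<rceil>)"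
  have "E n (\<lambda>g. of_bool (\<bar>\<phi> g\<bar> \<le> a * sqrt (real n))) \<le> \<epsilon>" if n: "k * m0 \<le> n" for n
  proof -
    define m q where "m = n div k" and "q = n mod k"
    have nq: "n = q + k * m" "q < k" using k by (simp_all add: m_def q_def)
    have "m0 \<le> m"
      unfolding m_def using n k by (metis div_le_mono nonzero_mult_div_cancel_left not_less0)
    then have m: "N \<le> m" "1 \<le> m" "(2 * \<tau> * R) ^ 2 \<le> real m"
      unfolding m0_def by (auto simp: nat_ceiling_le_eq)
    define \<eta> where "\<eta> = \<theta> / sqrt (real m)"
    have sm: "0 < sqrt (real m)" using m by simp
    have \<eta>: "0 < \<eta>" using \<theta> sm by (simp add: \<eta>_def)
    define h where "h v = real J ^ 2 / 2 * of_bool (\<bar>v\<bar> \<le> a * sqrt (real n))" for v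
    have R: "2 * \<tau> * R \<le> sqrt (real m)"
      using m(3) by (rule real_le_rsqrt)
    have dom: "h v \<le> fejer J \<eta> w" if vw: "\<bar>v - w\<bar> \<le> 0 + real q * (D + L) + real k * D" for v w
    proof (cases "\<bar>v\<bar> \<le> a * sqrt (real n)")
      case True
      have "real n \<le> 2 * real k * real m"
      proof -
        have "q \<le> k * m" using nq(2) m(2) by (metis less_imp_le_nat mult_le_mono2 nat_mult_1_right order_trans)
        then have "n \<le> 2 * (k * m)" using nq(1) by simp
        then show ?thesis by (metis of_nat_le_iff of_nat_mult of_nat_numeral mult.assoc)
      qed
      then have "sqrt (real n) \<le> sqrt (2 * real k) * sqrt (real m)"
        by (metis real_sqrt_le_iff real_sqrt_mult)
      then have "a * sqrt (real n) \<le> a * (sqrt (2 * real k) * sqrt (real m))"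
        using a by (intro mult_left_mono) auto
      also have "\<dots> = sqrt (real m) / (2 * \<tau>)"
        using k by (simp add: a_def)
      finally have v: "\<bar>v\<bar> \<le> sqrt (real m) / (2 * \<tau>)" using True by simp
      have "real q * (D + L) + real k * D \<le> real k * (D + L) + real k * D"
        using nq(2) D0 L0 by (intro add_mono mult_right_mono) auto
      also have "\<dots> = R" by (simp add: R_def algebra_simps)
      also have "R \<le> sqrt (real m) / (2 * \<tau>)"
        using R \<tau>(1) by (simp add: field_simps)
      finally have "\<bar>w\<bar> \<le> sqrt (real m) / (2 * \<tau>) + sqrt (real m) / (2 * \<tau>)"
        using v vw by linarith
      also have "\<dots> = sqrt (real m) / \<tau>" using \<tau>(1) by (simp add: field_simps)
      finally have w: "\<bar>w\<bar> \<le> sqrt (real m) / \<tau>" .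
      have "real J * \<bar>\<eta>\<bar> = \<tau> / sqrt (real m)"
        using J0 \<tau>(1) by (simp add: \<eta>_def \<theta>_def)
      then have "real J * \<bar>\<eta>\<bar> * \<bar>w\<bar> \<le> \<tau> / sqrt (real m) * (sqrt (real m) / \<tau>)"
        using w \<tau>(1) by (simp only:) (intro mult_left_mono, auto)
      also have "\<dots> = 1" using \<tau>(1) sm by simp
      finally have "real J ^ 2 / 2 \<le> fejer J \<eta> w"
        by (rule fejer_ge)
      then show ?thesis
        using True by (simp add: h_def)
    next
      case False
      then show ?thesis using fejer_nonneg by (simp add: h_def)
    qed
    have "E n (\<lambda>g. h (\<phi> (\<one> \<otimes> g))) \<le> block_mean \<phi> m k (fejer J \<eta>) 0"
      unfolding nq(1)
    proof (rule mean_le_block_mean_remainder[OF D L])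
      show "\<bar>\<phi> \<one>\<bar> \<le> 0"
        using homogeneous_quasimorphism_pow(3)[OF \<phi>(1) one_closed] by simp
      show "h v \<le> fejer J \<eta> w" if "\<bar>v - w\<bar> \<le> 0 + real q * (D + L) + real k * D" for v w
        using that by (rule dom)
    qed simp_all
    moreover have "E n (\<lambda>g. h (\<phi> (\<one> \<otimes> g))) = real J ^ 2 / 2 * E n (\<lambda>g. of_bool (\<bar>\<phi> g\<bar> \<le> a * sqrt (real n)))"
    proof -
      have "E n (\<lambda>g. h (\<phi> (\<one> \<otimes> g))) = E n (\<lambda>g. h (\<phi> g))" by (rule mean_cong) simp
      then show ?thesis unfolding h_def by (simp only: mean_scale)
    qed
    moreover have "block_mean \<phi> m k (fejer J \<eta>) 0 = (\<Sum>i<J. \<Sum>j<J. E m (\<lambda>g. cos ((real i - real j) * \<eta> * \<phi> g)) ^ k)"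
      unfolding fejer_def[abs_def] by (simp add: block_mean_sum block_mean_cos[OF \<phi>(1)])
    moreover have "(\<Sum>i<J. \<Sum>j<J. E m (\<lambda>g. cos ((real i - real j) * \<eta> * \<phi> g)) ^ k) \<le> (\<Sum>i<J. \<Sum>j<J. of_bool (i = j) + \<rho> ^ k)"
    proof (intro sum_mono)
      fix i j assume ij: "i \<in> {..<J}" "j \<in> {..<J}"
      show "E m (\<lambda>g. cos ((real i - real j) * \<eta> * \<phi> g)) ^ k \<le> of_bool (i = j) + \<rho> ^ k"
      proof (cases "i = j")
        case True
        then show ?thesis using \<open>0 \<le> \<rho>\<close> by (simp add: mean_const)
      next
        case False
        define d where "d = \<bar>real i - real j\<bar>"
        have d: "1 \<le> d" "d \<le> real J" using False ij by (auto simp: d_def)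
        have "cos ((real i - real j) * \<eta> * \<phi> g) = cos (d * \<theta> / sqrt (real m) * \<phi> g)" for g
        proof -
          have "d = real i - real j \<or> d = - (real i - real j)"
            unfolding d_def by linarith
          then have "d * (\<eta> * \<phi> g) = (real i - real j) * (\<eta> * \<phi> g) \<or>
              d * (\<eta> * \<phi> g) = - ((real i - real j) * (\<eta> * \<phi> g))"
            by (metis mult_minus_left)
          then have "cos (d * (\<eta> * \<phi> g)) = cos ((real i - real j) * (\<eta> * \<phi> g))"
            by (metis cos_minus)
          then show ?thesis by (simp add: \<eta>_def mult.assoc)
        qed
        moreover have "\<theta> \<le> d * \<theta>" "d * \<theta> \<le> \<tau>"
          using d \<theta> J0 mult_right_mono[of d "real J" \<theta>] mult_right_mono[of 1 d \<theta>] by (auto simp: \<theta>_def)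
        note char[OF m(1,2) this]
        ultimately have "E m (\<lambda>g. cos ((real i - real j) * \<eta> * \<phi> g)) ^ k \<le> \<rho> ^ k"
          by (intro power_mono) auto
        then show ?thesis using False by simp
      qed
    qed
    moreover have "(\<Sum>i<J. \<Sum>j<J. of_bool (i = j) + \<rho> ^ k) = real J + real J ^ 2 * \<rho> ^ k"
    proof -
      have "(\<Sum>j<J. of_bool (i = j) :: real) = 1" if "i < J" for i
        using that by (simp add: of_bool_def)
      then have "(\<Sum>i<J. \<Sum>j<J. of_bool (i = j) :: real) = real J" by simp
      then show ?thesis by (simp add: sum.distrib power2_eq_square algebra_simps)
    qed
    ultimately have "real J ^ 2 / 2 * E n (\<lambda>g. of_bool (\<bar>\<phi> g\<bar> \<le> a * sqrt (real n))) \<le> real J + real J ^ 2 * \<rho> ^ k"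
      by linarith
    also have "\<dots> \<le> real J ^ 2 / 2 * (\<epsilon> / 2) + real J ^ 2 * (\<epsilon> / 4)"
    proof (intro add_mono mult_left_mono k(2))
      have "4 \<le> real J * \<epsilon>" using J \<epsilon> by (simp add: field_simps)
      then have "real J * 4 \<le> real J * (real J * \<epsilon>)" by (intro mult_left_mono) auto
      then show "real J \<le> real J ^ 2 / 2 * (\<epsilon> / 2)" by (simp add: power2_eq_square)
    qed simp
    also have "\<dots> = real J ^ 2 / 2 * \<epsilon>" by simp
    finally show ?thesis
      by (rule mult_left_le_imp_le) (use J0 in simp)
  qed
  then have "\<forall>\<^sub>F n in sequentially. E n (\<lambda>g. of_bool (\<bar>\<phi> g\<bar> \<le> a * sqrt (real n))) \<le> \<epsilon>"
    unfolding eventually_sequentially by blast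
  then show ?thesis using that a by blast
qed

end

section \<open>Stable commutator length along the walk\<close>

text \<open>Markov's inequality, applied to the bound on \<open>scl\<close> by finitely many quasimorphisms.\<close>

lemma (in symmetric_walk) scl_upper_tail:
  assumes N: "0 < N" "\<And>g. g \<in> carrier G \<Longrightarrow> g [^] (N::nat) \<in> commutator_subgroup G"
    and fin: "finite_dimensional (homogeneous_quasimorphisms G)" and \<epsilon>: "0 < \<epsilon>"
  obtains b where "0 < b" "\<And>n. 1 \<le> n \<Longrightarrow> E n (\<lambda>g. of_bool (b * sqrt (real n) \<le> scl G g)) \<le> \<epsilon>"
proof -
  obtain F :: "'a set" and \<psi> C where F: "finite F" "\<And>x. x \<in> F \<Longrightarrow> \<psi> x \<in> homogeneous_quasimorphisms G" "0 \<le> C"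
    "\<And>g. g \<in> carrier G \<Longrightarrow> scl G g \<le> 3 + C * (\<Sum>x\<in>F. \<bar>\<psi> x g\<bar>)"
    by (rule scl_le_sum_quasimorphisms[OF N fin]) (assumption | rule that)+
  have "\<exists>B. 0 < B \<and> (\<forall>n\<ge>1. E n (\<lambda>g. \<psi> x g ^ 2) \<le> B * real n)" if "x \<in> F" for x
    using quasimorphism_moments_le[OF F(2)[OF that]] by metis
  then obtain B where B: "\<And>x. x \<in> F \<Longrightarrow> 0 < B x" "\<And>x n. x \<in> F \<Longrightarrow> 1 \<le> n \<Longrightarrow> E n (\<lambda>g. \<psi> x g ^ 2) \<le> B x * real n"
    by metis
  define K where "K = 3 + C * (\<Sum>x\<in>F. sqrt (B x))"
  have K: "0 < K"
    unfolding K_def using B(1) F(3) by (intro add_pos_nonneg mult_nonneg_nonneg sum_nonneg) (auto simp: less_imp_le)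
  have first: "E n (\<lambda>g. \<bar>\<psi> x g\<bar>) \<le> sqrt (B x) * sqrt (real n)" if "x \<in> F" "1 \<le> n" for x n
  proof -
    have "(E n (\<lambda>g. \<bar>\<psi> x g\<bar>)) ^ 2 \<le> E n (\<lambda>g. \<psi> x g ^ 2)"
      using mean_square[of n "\<lambda>g. \<bar>\<psi> x g\<bar>"] by simp
    also have "\<dots> \<le> B x * real n"
      by (rule B(2)[OF that])
    finally show ?thesis
      unfolding real_sqrt_mult[symmetric] by (rule real_le_rsqrt)
  qed
  have scl_mean: "E n (scl G) \<le> K * sqrt (real n)" if n: "1 \<le> n" for n
  proof -
    have "E n (scl G) \<le> E n (\<lambda>g. 3 + C * (\<Sum>x\<in>F. \<bar>\<psi> x g\<bar>))"
      by (rule mean_mono[OF F(4)])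
    also have "\<dots> = 3 + C * (\<Sum>x\<in>F. E n (\<lambda>g. \<bar>\<psi> x g\<bar>))"
      by (simp only: mean_add mean_const mean_scale mean_sum[OF F(1)])
    also have "\<dots> \<le> 3 * sqrt (real n) + C * (\<Sum>x\<in>F. sqrt (B x) * sqrt (real n))"
      using n F(3) by (intro add_mono mult_left_mono sum_mono first) auto
    also have "\<dots> = K * sqrt (real n)"
      by (simp only: K_def distrib_right mult.assoc sum_distrib_right)
    finally show ?thesis .
  qed
  define b where "b = K / \<epsilon>"
  have b: "0 < b" using K \<epsilon> by (simp add: b_def)
  have "E n (\<lambda>g. of_bool (b * sqrt (real n) \<le> scl G g)) \<le> \<epsilon>" if n: "1 \<le> n" for n
  proof -
    let ?t = "b * sqrt (real n)"
    have t: "0 < ?t" using b n by simp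
    have "E n (\<lambda>g. of_bool (?t \<le> scl G g)) \<le> E n (\<lambda>g. 1 / ?t * scl G g)"
    proof (rule mean_mono)
      fix g assume g: "g \<in> carrier G"
      show "of_bool (?t \<le> scl G g) \<le> 1 / ?t * scl G g"
        using t scl_nonneg[OF g N(1) N(2)[OF g]] by (auto simp: field_simps)
    qed
    also have "\<dots> = 1 / ?t * E n (scl G)"
      by (rule mean_scale)
    also have "\<dots> \<le> 1 / ?t * (K * sqrt (real n))"
      using t by (intro mult_left_mono scl_mean n) auto
    also have "\<dots> = \<epsilon>"
      using n K \<epsilon> by (simp add: b_def)
    finally show ?thesis .
  qed
  then show ?thesis using that b by blast
qed

theorem corollary6p10:
  fixes G :: "('a, 'b) monoid_scheme"
    and S :: "'a set"
    and M :: "'w measure"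
    and s :: "nat \<Rightarrow> 'w \<Rightarrow> 'a"
    and \<epsilon> :: real
  assumes "group G"
    and "finite (carrier (G Mod commutator_subgroup G))"
    and "finite S" and "S \<subseteq> carrier G" and "\<forall>x\<in>S. inv\<^bsub>G\<^esub> x \<in> S"
    and "generate G S = carrier G"
    and "finite_dimensional (homogeneous_quasimorphisms G)"
    and "homogeneous_quasimorphisms G \<noteq> {0}"
    and "prob_space M"
    and "prob_space.indep_vars M (\<lambda>_. count_space S) s UNIV"
    and "\<forall>i. distr M (count_space S) (s i) = uniform_count_measure S"
    and "\<epsilon> > 0"
  shows "\<exists>a>0. \<exists>b>0. \<forall>\<^sub>F n in sequentially.
           measure M {\<omega> \<in> space M. a < scl G (walk G s n \<omega>) / sqrt (real n) \<and>
                                   scl G (walk G s n \<omega>) / sqrt (real n) < b} \<ge> 1 - \<epsilon>"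
proof -
  have "S \<noteq> {}"
  proof -
    interpret prob_space M by (rule assms)
    obtain \<omega> where \<omega>: "\<omega> \<in> space M" using not_empty by blast
    have "s 0 \<in> measurable M (count_space S)"
      using assms(10) by (auto simp: indep_vars_def)
    from measurable_space[OF this \<omega>] show ?thesis by auto
  qed
  interpret group G by (rule assms)
  interpret symmetric_walk G S
    by unfold_locales (use assms \<open>S \<noteq> {}\<close> in auto)
  obtain N :: nat where N: "0 < N" "\<And>g. g \<in> carrier G \<Longrightarrow> g [^]\<^bsub>G\<^esub> N \<in> commutator_subgroup G"
    by (rule finite_abelianization_pow[OF assms(2)]) (rule that)
  obtain \<phi> where \<phi>: "\<phi> \<in> homogeneous_quasimorphisms G" "\<phi> \<noteq> 0"
    using assms(8) real_fun.subspace_0[OF subspace_homogeneous_quasimorphisms[of G]] by blast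
  obtain D where D: "defect_le G \<phi> D"
    by (rule homogeneous_quasimorphism_defect[OF \<phi>(1)])
  have D0: "0 \<le> D" by (rule defect_le_nonneg[OF D])
  have half: "0 < \<epsilon> / 2" using assms(12) by simp
  obtain a where a: "0 < a"
    "\<forall>\<^sub>F n in sequentially. E n (\<lambda>g. of_bool (\<bar>\<phi> g\<bar> \<le> a * sqrt (real n))) \<le> \<epsilon> / 2"
    by (rule quasimorphism_anticoncentration[OF \<phi> assms(6) half]) (rule that)
  obtain b where b: "0 < b" "\<And>n. 1 \<le> n \<Longrightarrow> E n (\<lambda>g. of_bool (b * sqrt (real n) \<le> scl G g)) \<le> \<epsilon> / 2"
    by (rule scl_upper_tail[OF N assms(7) half]) (assumption | rule that)+
  \<comment> \<open>The bound \<open>D\<close> on the defect may be zero, whence \<open>D + 1\<close>.\<close>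
  define a' where "a' = a / (4 * (D + 1))"
  have a': "0 < a'" using a(1) D0 by (simp add: a'_def)
  have "\<forall>\<^sub>F n in sequentially. measure M {\<omega> \<in> space M. a' < scl G (walk G s n \<omega>) / sqrt (real n) \<and>
      scl G (walk G s n \<omega>) / sqrt (real n) < b} \<ge> 1 - \<epsilon>"
    using a(2) eventually_ge_at_top[of 1]
  proof eventually_elim
    case (elim n)
    have sn: "0 < sqrt (real n)" using elim(2) by simp
    define good where "good g \<longleftrightarrow> a' < scl G g / sqrt (real n) \<and> scl G g / sqrt (real n) < b" for g
    have "1 - of_bool (\<bar>\<phi> g\<bar> \<le> a * sqrt (real n)) - of_bool (b * sqrt (real n) \<le> scl G g) \<le> (of_bool (good g) :: real)"
      if g: "g \<in> carrier G" for g
    proof -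
      have "\<bar>\<phi> g\<bar> \<le> a * sqrt (real n)" if "scl G g \<le> a' * sqrt (real n)"
      proof -
        have "\<bar>\<phi> g\<bar> \<le> 4 * D * scl G g"
          by (rule homogeneous_quasimorphism_le_scl[OF \<phi>(1) D g N(1) N(2)[OF g]])
        also have "\<dots> \<le> 4 * (D + 1) * scl G g"
          using scl_nonneg[OF g N(1) N(2)[OF g]] by (intro mult_right_mono) auto
        also have "\<dots> \<le> 4 * (D + 1) * (a' * sqrt (real n))"
          using that D0 by (intro mult_left_mono) auto
        also have "\<dots> = a * sqrt (real n)"
          using D0 by (simp add: a'_def)
        finally show ?thesis .
      qed
      moreover have "good g \<longleftrightarrow> a' * sqrt (real n) < scl G g \<and> scl G g < b * sqrt (real n)"
        unfolding good_def by (simp only: pos_less_divide_eq[OF sn] pos_divide_less_eq[OF sn])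
      ultimately show ?thesis
        by (cases "scl G g \<le> a' * sqrt (real n)"; cases "b * sqrt (real n) \<le> scl G g") auto
    qed
    then have "E n (\<lambda>g. 1 - of_bool (\<bar>\<phi> g\<bar> \<le> a * sqrt (real n)) - of_bool (b * sqrt (real n) \<le> scl G g)) \<le>
        E n (\<lambda>g. of_bool (good g))"
      by (rule mean_mono)
    then have "1 - \<epsilon> \<le> E n (\<lambda>g. of_bool (good g))"
      unfolding mean_diff mean_const using elim(1) b(2)[OF elim(2)] by linarith
    also have "\<dots> = measure M {\<omega> \<in> space M. good (walk G s n \<omega>)}"
      using assms(11) by (intro prob_walk[symmetric] assms(9,10)) auto
    finally show ?case by (simp add: good_def)
  qed
  then show ?thesis using a' b(1) by blast
qed

end
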